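(* For every integer $n\ge 0$ and every integer $m$, the number of overpartitions $\vec{\pi}$ of $n$ with $\operatorname{crank2}(\vec{\pi})=m$ equals $\overline{M2}(m,n)$, where the integers $\overline{M2}(m,n)$ are defined by $$\sum_{n=0}^\infty\sum_{m}\overline{M2}(m,n)z^mq^n=\frac{(-q;q)_\infty(q^2;q^2)_\infty}{(q;q^2)_\infty(zq^2;q^2)_\infty(z^{-1}q^2;q^2)_\infty}.$$
   Context: Notation: $(a;q)_\infty=\prod_{k=0}^\infty(1-aq^k)$; the generating function is expanded as a formal power series in $q$ whose coefficients are Laurent polynomials in $z$. An overpartition of $n$ is a partition of $n$ in which the first occurrence of each part size may be overlined. It is identified with a triple $\vec{\pi}=(\pi_1,\pi_2,\pi_3)\in\mathcal{PD}\times\mathcal{PE}\times\mathcal{PO}$ with $|\pi_1|+|\pi_2|+|\pi_3|=n$, where $\mathcal{PD}$, $\mathcal{PE}$, $\mathcal{PO}$ are the sets of partitions into distinct parts, into even parts, and into odd parts respectively (each including the empty partition $\varnothing$), $|\pi|$ is the sum of the parts of $\pi$, $\pi_1$ consists of the overlined parts, $\pi_2$ of the even non-overlined parts, and $\pi_3$ of the odd non-overlined parts. For a non-empty partition $\pi$, let $\ell(\pi)$ be its largest part, $\omega(\pi)$ the number of ones in $\pi$, and $\mu(\pi)$ the number of parts of $\pi$ larger than $\omega(\pi)$. The crank is $$\operatorname{crank}(\pi)=\begin{cases}\ell(\pi)&\text{if }\omega(\pi)=0,\\ \mu(\pi)-\omega(\pi)&\text{otherwise.}\end{cases}$$ For $\pi\in\mathcal{PE}$,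 $\frac{\pi}{2}$ denotes the partition obtained by dividing each part of $\pi$ by $2$. For a non-empty partition $\pi$ into distinct parts define $\kappa(\pi)$ as follows. Case I: if $\ell(\pi)\ge 4$, then $\kappa(\pi)=0$ if $\ell(\pi)-1$ or $\ell(\pi)-2$ (at least one of them) is a part of $\pi$, and $\kappa(\pi)=1$ otherwise. Case II: if $\ell(\pi)\in\{2,3\}$, then $\kappa(\pi)=1$ if $\pi$ has only one part, and $\kappa(\pi)=0$ otherwise. Case III: if $\ell(\pi)=1$, then $\kappa(\pi)=0$. For an overpartition $\vec\pi=(\pi_1,\pi_2,\pi_3)\in\mathcal{PD}\times\mathcal{PE}\times\mathcal{PO}$ define $$\operatorname{crank2}(\vec{\pi})=\begin{cases}\operatorname{crank}\bigl(\frac{\pi_2}{2}\bigr)&\text{if }\pi_2\ne\varnothing,\\ \kappa(\pi_1)&\text{if }\pi_2=\varnothing\text{ and }\pi_1\ne\varnothing,\\ 0&\text{otherwise.}\end{cases}$$ *)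

theory Defs
  imports
    "HOL-Library.Multiset"
    "HOL-Library.Poly_Mapping"
    "HOL-Computational_Algebra.Formal_Power_Series"
    "HOL-Analysis.Infinite_Products"
begin

section \<open>Overpartitions and their crank\<close>

definition partitions :: "nat multiset set" where
  "partitions = {\<pi>. 0 \<notin># \<pi>}"

definition PD :: "nat multiset set" where
  "PD = {\<pi> \<in> partitions. \<forall>k. count \<pi> k \<le> 1}"

definition PE :: "nat multiset set" where
  "PE = {\<pi> \<in> partitions. \<forall>k\<in>#\<pi>. even k}"

definition PO :: "nat multiset set" where
  "PO = {\<pi> \<in> partitions. \<forall>k\<in>#\<pi>. odd k}"

type_synonym overpartition = "nat multiset \<times> nat multiset \<times> nat multiset"

text \<open>The components are the overlined parts, the even non-overlined parts and the odd
  non-overlined parts.\<close>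

definition overpartitions :: "nat \<Rightarrow> overpartition set" where
  "overpartitions n =
     {(\<pi>1, \<pi>2, \<pi>3). \<pi>1 \<in> PD \<and> \<pi>2 \<in> PE \<and> \<pi>3 \<in> PO \<and> \<Sum>\<^sub># \<pi>1 + \<Sum>\<^sub># \<pi>2 + \<Sum>\<^sub># \<pi>3 = n}"

text \<open>\<open>largest\<close>, \<open>crank\<close> and \<open>kappa\<close> are only meaningful for non-empty partitions, and are
  only used for those in \<open>crank2\<close>.\<close>

definition largest :: "nat multiset \<Rightarrow> nat" where
  "largest \<pi> = Max (set_mset \<pi>)"

definition ones :: "nat multiset \<Rightarrow> nat" where
  "ones \<pi> = count \<pi> 1"

definition mu :: "nat multiset \<Rightarrow> nat" where
  "mu \<pi> = size {#k \<in># \<pi>. k > ones \<pi>#}"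

definition crank :: "nat multiset \<Rightarrow> int" where
  "crank \<pi> = (if ones \<pi> = 0 then int (largest \<pi>) else int (mu \<pi>) - int (ones \<pi>))"

definition half :: "nat multiset \<Rightarrow> nat multiset" where
  "half \<pi> = image_mset (\<lambda>k. k div 2) \<pi>"

definition kappa :: "nat multiset \<Rightarrow> int" where
  "kappa \<pi> =
    (if largest \<pi> \<ge> 4 then (if largest \<pi> - 1 \<in># \<pi> \<or> largest \<pi> - 2 \<in># \<pi> then 0 else 1)
     else if largest \<pi> \<in> {2, 3} then (if size \<pi> = 1 then 1 else 0)
     else 0)"

fun crank2 :: "overpartition \<Rightarrow> int" where
  "crank2 (\<pi>1, \<pi>2, \<pi>3) =
    (if \<pi>2 \<noteq> {#} then crank (half \<pi>2)
     else if \<pi>1 \<noteq> {#} then kappa \<pi>1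
     else 0)"

lemma finite_overpartitions: "finite (overpartitions n)"
proof -
  define B where "B = (\<Sum>k\<in>{1..n}. replicate_mset n k)"
  have sub: "\<pi> \<subseteq># B" if p: "\<pi> \<in> partitions" and s: "\<Sum>\<^sub># \<pi> \<le> n" for \<pi>
  proof (rule mset_subset_eqI)
    fix k
    show "count \<pi> k \<le> count B k"
    proof (cases "k \<in># \<pi>")
      case True
      have k0: "k > 0" using p True unfolding partitions_def by (cases k) auto
      have "replicate_mset (count \<pi> k) k \<subseteq># \<pi>"
        by (simp add: count_le_replicate_mset_subset_eq[symmetric])
      then obtain C where "\<pi> = replicate_mset (count \<pi> k) k + C"
        by (metis mset_subset_eq_exists_conv)
      then have "\<Sum>\<^sub># \<pi> = count \<pi> k * k + \<Sum>\<^sub># C"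
        by (metis sum_mset.union sum_mset_replicate_mset of_nat_id)
      then have le: "count \<pi> k * k \<le> n" using s by simp
      have c0: "count \<pi> k \<ge> 1" using True by simp
      have "count \<pi> k * 1 \<le> count \<pi> k * k"
        using k0 by (intro mult_le_mono2) simp
      moreover have "1 * k \<le> count \<pi> k * k"
        using c0 by (intro mult_le_mono1)
      ultimately have ck: "count \<pi> k \<le> n" and kn: "k \<le> n" using le by linarith+
      have "count B k = (\<Sum>j\<in>{1..n}. if j = k then n else 0)"
        unfolding B_def by (simp add: count_sum)
      also have "\<dots> = n" using k0 kn by (simp add: sum.delta)
      finally show ?thesis using ck by simp
    qed (simp add: not_in_iff)
  qed
  have "overpartitions n \<subseteq> {A. A \<subseteq># B} \<times> {A. A \<subseteq># B} \<times> {A. A \<subseteq># B}"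
    unfolding overpartitions_def PD_def PE_def PO_def by (auto intro!: sub)
  moreover have "finite {A. A \<subseteq># B}"
  proof (rule finite_subset)
    show "{A. A \<subseteq># B} \<subseteq> (\<Union>k\<le>size B. multisets_of_size (set_mset B) k)"
      by (auto simp: multisets_of_size_def size_mset_mono dest: mset_subset_eqD)
  qed auto
  ultimately show ?thesis by (meson finite_SigmaI finite_subset)
qed

section \<open>The generating function\<close>

text \<open>Laurent polynomials in \<open>z\<close> with integer coefficients are finitely supported functions
  from exponents to coefficients, under convolution; power series in \<open>q\<close> over them carry the
  \<open>q\<close>-adic topology, in which the infinite products converge.\<close>

type_synonym laurent_poly = "int \<Rightarrow>\<^sub>0 int"

definition zpow :: "int \<Rightarrow> laurent_poly fps" where
  "zpow m = fps_const (Poly_Mapping.single m 1)"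

abbreviation qvar :: "laurent_poly fps" where
  "qvar \<equiv> fps_X"

definition qpoch_inf :: "laurent_poly fps \<Rightarrow> laurent_poly fps \<Rightarrow> laurent_poly fps" where
  "qpoch_inf a q = prodinf (\<lambda>k. 1 - a * q ^ k)"

definition M2bar_num :: "laurent_poly fps" where
  "M2bar_num = qpoch_inf (- qvar) qvar * qpoch_inf (qvar\<^sup>2) (qvar\<^sup>2)"

definition M2bar_den :: "laurent_poly fps" where
  "M2bar_den =
     qpoch_inf qvar (qvar\<^sup>2) * qpoch_inf (zpow 1 * qvar\<^sup>2) (qvar\<^sup>2) *
     qpoch_inf (zpow (-1) * qvar\<^sup>2) (qvar\<^sup>2)"

text \<open>Laurent polynomials do not form a field, so there is no division operator for these
  series. The denominator has constant coefficient 1 and \<open>fps_right_inverse M2bar_den 1\<close> is its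
  reciprocal; see \<open>M2bar_den_inverse\<close> and \<open>M2bar_gf_unique\<close> below.\<close>

definition M2bar_gf :: "laurent_poly fps" where
  "M2bar_gf = M2bar_num * fps_right_inverse M2bar_den 1"

definition M2bar :: "int \<Rightarrow> nat \<Rightarrow> int" where
  "M2bar m n = Poly_Mapping.lookup (fps_nth M2bar_gf n) m"

lemma
  assumes "fps_nth a 0 = 0" "fps_nth q 0 = 0"
  shows qpoch_inf_has_prod: "(\<lambda>k. 1 - a * q ^ k) has_prod qpoch_inf a q"
    and qpoch_inf_nth_0: "fps_nth (qpoch_inf a q) 0 = 1"
proof -
  define P where "P N = (\<Prod>k\<le>N. 1 - a * q ^ k)" for N
  have low: "fps_nth (a * q ^ k) i = 0" if "i \<le> k" for i k
  proof (cases "a * q ^ k = 0")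
    case False
    then have "a \<noteq> 0" "q ^ k \<noteq> 0" by auto
    have sd: "subdegree a \<ge> 1"
      using assms(1) \<open>a \<noteq> 0\<close> by (metis One_nat_def Suc_leI neq0_conv nth_subdegree_nonzero)
    have "subdegree (q ^ k) \<ge> k"
    proof (cases "k = 0")
      case F: False
      then have "q \<noteq> 0" using \<open>q ^ k \<noteq> 0\<close> by auto
      then have "subdegree q \<ge> 1"
        using assms(2) by (metis One_nat_def Suc_leI neq0_conv nth_subdegree_nonzero)
      then have "k * 1 \<le> k * subdegree q" by (intro mult_le_mono) auto
      then show ?thesis by (simp add: subdegree_power)
    qed simp
    moreover have "subdegree (a * q ^ k) = subdegree a + subdegree (q ^ k)"
      using \<open>a \<noteq> 0\<close> \<open>q ^ k \<noteq> 0\<close> by simp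
    ultimately show ?thesis using sd that by (intro nth_less_subdegree_zero) linarith
  next
    case True
    then show ?thesis by (simp only: fps_zero_nth)
  qed
  have step: "fps_nth (P (Suc N)) n = fps_nth (P N) n" if "n \<le> N" for N n
  proof -
    have "fps_nth (P N * (a * q ^ Suc N)) n = 0"
      unfolding fps_mult_nth[of "P N"] using that
      by (intro sum.neutral ballI) (simp add: low del: power_Suc)
    then show ?thesis by (simp add: P_def algebra_simps)
  qed
  have stable: "fps_nth (P N) n = fps_nth (P n) n" if "n \<le> N" for N n
    using that by (induction N rule: dec_induct) (simp_all add: step)
  define L where "L = Abs_fps (\<lambda>n. fps_nth (P n) n)"
  have lim: "P \<longlonglongrightarrow> L"
    by (rule tendsto_fpsI) (auto simp: L_def eventually_sequentially intro!: stable)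
  have L0: "fps_nth L 0 = 1" using assms by (simp add: L_def P_def)
  then have "L \<noteq> 0" by auto
  with lim have hp: "(\<lambda>k. 1 - a * q ^ k) has_prod L"
    unfolding has_prod_def raw_has_prod_def P_def by simp
  then have "qpoch_inf a q = L"
    unfolding qpoch_inf_def by (rule has_prod_unique[symmetric])
  with hp L0 show "(\<lambda>k. 1 - a * q ^ k) has_prod qpoch_inf a q" "fps_nth (qpoch_inf a q) 0 = 1"
    by auto
qed

lemma M2bar_den_inverse: "M2bar_den * fps_right_inverse M2bar_den 1 = 1"
proof (rule fps_right_inverse)
  show "fps_nth M2bar_den 0 * 1 = 1"
    by (simp add: M2bar_den_def qpoch_inf_nth_0)
qed

lemma M2bar_gf_unique: "F * M2bar_den = M2bar_num \<longleftrightarrow> F = M2bar_gf"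
proof
  assume "F * M2bar_den = M2bar_num"
  then have "M2bar_gf = F * (M2bar_den * fps_right_inverse M2bar_den 1)"
    unfolding M2bar_gf_def by (metis mult.assoc)
  then show "F = M2bar_gf" using M2bar_den_inverse by simp
next
  assume "F = M2bar_gf"
  then have "F * M2bar_den = M2bar_num * (M2bar_den * fps_right_inverse M2bar_den 1)"
    unfolding M2bar_gf_def by (simp only: ac_simps)
  then show "F * M2bar_den = M2bar_num" using M2bar_den_inverse by simp
qed

end

theory Submission
  imports Defs
begin

text \<open>With \<open>q\<close> replaced by \<open>q\<^sup>2\<close>, the classical crank series \<open>(q;q) / ((zq;q) (q/z;q))\<close> gives the
  factor of the even non-overlined parts. Following Andrews and Garvan, the \<open>q\<close>-binomial theorem
  expands it as \<open>1 + (z - 1) q\<close> plus the generating function of the crank over non-empty partitions.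
  The anomalous term contributes \<open>(z - 1) q\<^sup>2 D(q)\<close> times the factor of the odd parts, where \<open>D\<close>
  counts partitions into distinct parts. It is absorbed by \<open>kappa\<close>: increasing the largest part
  by 2 maps the partitions of \<open>n - 2\<close> into distinct parts bijectively onto those of \<open>n\<close> with
  \<open>kappa = 1\<close>, the empty partition going to the partition 2.\<close>

text \<open>Write Q for q^d, where \<open>d\<close> scales all sizes (d = 2 in the end), and Z for
  the reciprocal of the infinite product (zQ;Q): the series of partitions in which z counts the
  parts. Since (Q;Q) = (1 - Q) (Q^2;Q), the crank product is (1 - Q) Z times (Q^2;Q)/(Q/z;Q). The
  q-binomial theorem with a = zQ and t = Q/z, chosen so that a t = Q^2, turns this into a sum with
  summand (1 - Q)/(Q;Q)_n times (zQ;Q)_n Z times (Q/z)^n. For n > 0 the three factors are the parts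
  from 2 to n, the parts above n marked by z, and n ones marked by 1/z, so the weight is z^(mu -
  omega). The summand n = 0 is (1 - Q) Z, where z has to be moved from the number of parts to the
  largest part; the leftover there is 1 - Q + zQ. As the coefficient ring has no division,
  reciprocals are realised as generating functions of partitions and identities are stated without
  quotients.\<close>

section \<open>Limits and infinite sums of formal power series\<close>

text \<open>Convergence means that each coefficient is eventually constant, and a coefficient of a
  product depends on finitely many coefficients of the factors.\<close>

lemma fps_tendsto_mult:
  fixes L M :: "'a::comm_ring_1 fps"
  assumes "(f \<longlongrightarrow> L) F" "(g \<longlongrightarrow> M) F"
  shows "((\<lambda>x. f x * g x) \<longlongrightarrow> L * M) F"
proof (rule tendsto_fpsI)
  fix n
  have "eventually (\<lambda>x. \<forall>i\<in>{..n}. fps_nth (f x) i = fps_nth L i) F"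
    using assms(1) by (intro eventually_ball_finite) (auto simp: tendsto_fps_iff)
  moreover have "eventually (\<lambda>x. \<forall>i\<in>{..n}. fps_nth (g x) i = fps_nth M i) F"
    using assms(2) by (intro eventually_ball_finite) (auto simp: tendsto_fps_iff)
  ultimately show "eventually (\<lambda>x. fps_nth (f x * g x) n = fps_nth (L * M) n) F"
    by eventually_elim (auto simp: fps_mult_nth intro!: sum.cong)
qed

lemma nth_mult_power_eq_0:
  fixes t :: "'a::comm_ring_1 fps"
  assumes "fps_nth t 0 = 0" "N < n"
  shows "fps_nth (g * t ^ n) N = 0"
  unfolding fps_mult_nth using assms startsby_zero_power_prefix[OF assms(1), of n]
  by (intro sum.neutral) auto

lemma qpoch_inf_LIMSEQ:
  assumes "fps_nth a 0 = 0" "fps_nth q 0 = 0"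
  shows "(\<lambda>N. \<Prod>k<N. 1 - a * q ^ k) \<longlonglongrightarrow> qpoch_inf a q"
proof (rule LIMSEQ_imp_Suc)
  \<comment> \<open>A nonzero value rules out the alternative in \<open>has_prod_def\<close> that
    skips a vanishing factor.\<close>
  have "qpoch_inf a q \<noteq> 0"
    using qpoch_inf_nth_0[OF assms] by auto
  then have "raw_has_prod (\<lambda>k. 1 - a * q ^ k) 0 (qpoch_inf a q)"
    using qpoch_inf_has_prod[OF assms] unfolding has_prod_def by auto
  then show "(\<lambda>N. \<Prod>k<Suc N. 1 - a * q ^ k) \<longlonglongrightarrow> qpoch_inf a q"
    by (simp add: raw_has_prod_def lessThan_Suc_atMost)
qed

text \<open>Summability is not required: the value is the infinite sum if \<open>f n\<close> has no terms of degree
  below \<open>n\<close>, and meaningless otherwise.\<close>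

definition fps_suminf :: "(nat \<Rightarrow> 'a::comm_ring_1 fps) \<Rightarrow> 'a fps" where
  "fps_suminf f = Abs_fps (\<lambda>N. \<Sum>n\<le>N. fps_nth (f n) N)"

text \<open>The freedom in the cut-off \<open>K\<close> lets coefficients of different degrees be
  summed over one common range, as products and index shifts require.\<close>

lemma fps_suminf_nth:
  assumes "\<And>n N. N < n \<Longrightarrow> fps_nth (f n) N = 0" "N \<le> K"
  shows "fps_nth (fps_suminf f) N = (\<Sum>n\<le>K. fps_nth (f n) N)"
  unfolding fps_suminf_def fps_nth_Abs_fps
  by (rule sum.mono_neutral_left) (use assms in \<open>auto simp: not_le\<close>)

lemma fps_suminf_diff: "fps_suminf (\<lambda>n. f n - g n) = fps_suminf f - fps_suminf g"
  by (rule fps_ext) (simp add: fps_suminf_def sum_subtractf)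

lemma fps_suminf_mult_left:
  assumes "\<And>n N. N < n \<Longrightarrow> fps_nth (f n) N = 0"
  shows "fps_suminf (\<lambda>n. g * f n) = g * fps_suminf f"
proof (rule fps_ext)
  fix N
  have "fps_nth (g * fps_suminf f) N
      = (\<Sum>i=0..N. fps_nth g i * (\<Sum>n\<le>N. fps_nth (f n) (N - i)))"
    unfolding fps_mult_nth
    by (intro sum.cong refl arg_cong2[where f = times] fps_suminf_nth assms) auto
  also have "\<dots> = (\<Sum>n\<le>N. fps_nth (g * f n) N)"
    unfolding fps_mult_nth sum_distrib_left by (rule sum.swap)
  finally show "fps_nth (fps_suminf (\<lambda>n. g * f n)) N = fps_nth (g * fps_suminf f) N"
    by (simp add: fps_suminf_def)
qed

lemma fps_suminf_Suc:
  assumes "\<And>n N. N < n \<Longrightarrow> fps_nth (f n) N = 0"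
  shows "fps_suminf f = f 0 + fps_suminf (\<lambda>n. f (Suc n))"
proof (rule fps_ext)
  fix N
  have "fps_nth (fps_suminf f) N = (\<Sum>n\<le>Suc N. fps_nth (f n) N)"
    by (rule fps_suminf_nth[OF assms]) auto
  also have "\<dots> = fps_nth (f 0) N + (\<Sum>n\<le>N. fps_nth (f (Suc n)) N)"
    by (rule sum.atMost_Suc_shift)
  finally show "fps_nth (fps_suminf f) N = fps_nth (f 0 + fps_suminf (\<lambda>n. f (Suc n))) N"
    by (simp add: fps_suminf_def)
qed

text \<open>The \<open>q\<close>-binomial theorem: \<open>c n\<close> is \<open>(a;q)\<^sub>n / (q;q)\<^sub>n\<close>. Both products are obtained by iterating
  \<open>(1 - t) F(t) = (1 - a t) F(t q)\<close>.\<close>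

lemma q_binomial:
  assumes c0: "c 0 = 1"
    and c: "\<And>n. c (Suc n) * (1 - q ^ Suc n) = c n * (1 - a * q ^ n)"
    and t0: "fps_nth t 0 = 0" and q0: "fps_nth q 0 = 0"
  shows "fps_suminf (\<lambda>n. c n * t ^ n) * qpoch_inf t q = qpoch_inf (a * t) q"
proof -
  \<comment> \<open>\<open>F k\<close> is the series evaluated at \<open>t * q ^ k\<close>.\<close>
  define F where "F k = fps_suminf (\<lambda>n. c n * q ^ (k * n) * t ^ n)" for k
  have low: "fps_nth (g n * t ^ n) N = 0" if "N < n" for n N g
    using nth_mult_power_eq_0[OF t0 that] .
  have step: "(1 - t * q ^ k) * F k = (1 - a * t * q ^ k) * F (Suc k)" for k
  proof -
    have "F k - F (Suc k)
        = fps_suminf (\<lambda>n. (c n * q ^ (k * n) * (1 - q ^ n)) * t ^ n)"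
      unfolding F_def fps_suminf_diff[symmetric]
      by (intro arg_cong[where f = fps_suminf] ext) (simp add: algebra_simps power_add)
    \<comment> \<open>The term at \<open>n = 0\<close> carries the factor
      \<open>1 - q ^ 0 = 0\<close>, so the index can be shifted.\<close>
    also have "\<dots> = fps_suminf (\<lambda>n. (c (Suc n) * q ^ (k * Suc n) * (1 - q ^ Suc n)) * t ^ Suc n)"
      by (subst fps_suminf_Suc[OF low]) simp_all
    also have "\<dots> = fps_suminf (\<lambda>n. t * q ^ k * (c n * q ^ (k * n) * t ^ n)
                      - t * q ^ k * a * (c n * q ^ (Suc k * n) * t ^ n))"
    proof (rule arg_cong[where f = fps_suminf], rule ext)
      fix n
      have "(c (Suc n) * q ^ (k * Suc n) * (1 - q ^ Suc n)) * t ^ Suc n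
          = (c (Suc n) * (1 - q ^ Suc n)) * (q ^ (k * Suc n) * t ^ Suc n)"
        by (simp only: ac_simps)
      also have "\<dots> = c n * (1 - a * q ^ n) * (q ^ (k * Suc n) * t ^ Suc n)"
        by (simp only: c)
      also have "\<dots> = t * q ^ k * (c n * q ^ (k * n) * t ^ n)
                      - t * q ^ k * a * (c n * q ^ (Suc k * n) * t ^ n)"
        by (simp add: algebra_simps power_add)
      finally show "(c (Suc n) * q ^ (k * Suc n) * (1 - q ^ Suc n)) * t ^ Suc n = \<dots>" .
    qed
    also have "\<dots> = t * q ^ k * F k - t * q ^ k * a * F (Suc k)"
      unfolding F_def fps_suminf_diff by (intro arg_cong2[where f = minus] fps_suminf_mult_left low)
    finally show ?thesis by (simp add: algebra_simps)
  qed
  have iter: "F 0 * (\<Prod>k<K. 1 - t * q ^ k) = (\<Prod>k<K. 1 - a * t * q ^ k) * F K" for K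
  proof (induction K)
    case (Suc K)
    have "F 0 * (\<Prod>k<Suc K. 1 - t * q ^ k) = (1 - t * q ^ K) * (F 0 * (\<Prod>k<K. 1 - t * q ^ k))"
      by (simp add: ac_simps)
    also have "\<dots> = (\<Prod>k<K. 1 - a * t * q ^ k) * ((1 - t * q ^ K) * F K)"
      by (subst Suc) (simp add: ac_simps)
    also have "\<dots> = (\<Prod>k<Suc K. 1 - a * t * q ^ k) * F (Suc K)"
      by (subst step) (simp add: ac_simps)
    finally show ?case .
  qed simp
  \<comment> \<open>Every term of \<open>F k\<close> except the constant one is divisible by
    \<open>q ^ k\<close>.\<close>
  have F_lim: "F \<longlonglongrightarrow> 1"
  proof (rule tendsto_fpsI)
    fix N
    show "eventually (\<lambda>k. fps_nth (F k) N = fps_nth 1 N) sequentially"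
      using eventually_gt_at_top[of N]
    proof eventually_elim
      case (elim k)
      have "fps_nth (c (Suc n) * q ^ (k * Suc n) * t ^ Suc n) N = 0" for n
        using nth_mult_power_eq_0[OF q0, of N "k * Suc n" "c (Suc n) * t ^ Suc n"] elim
        by (simp add: ac_simps trans_less_add1)
      then have "fps_nth (fps_suminf (\<lambda>n. c (Suc n) * q ^ (k * Suc n) * t ^ Suc n)) N = 0"
        by (simp add: fps_suminf_def del: power_Suc mult_Suc_right)
      then show ?case
        unfolding F_def by (subst fps_suminf_Suc[OF low]) (simp_all add: c0)
    qed
  qed
  have "(\<lambda>K. F 0 * (\<Prod>k<K. 1 - t * q ^ k)) \<longlonglongrightarrow> F 0 * qpoch_inf t q"
    by (intro fps_tendsto_mult tendsto_const qpoch_inf_LIMSEQ t0 q0)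
  moreover have "(\<lambda>K. (\<Prod>k<K. 1 - a * t * q ^ k) * F K) \<longlonglongrightarrow> qpoch_inf (a * t) q * 1"
    by (intro fps_tendsto_mult F_lim qpoch_inf_LIMSEQ q0) (simp add: t0)
  ultimately have "F 0 * qpoch_inf t q = qpoch_inf (a * t) q * 1"
    unfolding iter by (rule LIMSEQ_unique)
  then show ?thesis by (simp add: F_def)
qed

section \<open>Weighted generating functions\<close>

definition gf :: "'a set \<Rightarrow> ('a \<Rightarrow> nat) \<Rightarrow> ('a \<Rightarrow> 'b::comm_ring_1) \<Rightarrow> 'b fps" where
  "gf S s w = Abs_fps (\<lambda>n. \<Sum>x\<in>{x\<in>S. s x = n}. w x)"

text \<open>A sum over an infinite set is 0 by convention, so \<open>gf\<close> is additive and
  multiplicative only under a finiteness condition.\<close>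

definition finite_fibres :: "'a set \<Rightarrow> ('a \<Rightarrow> nat) \<Rightarrow> bool" where
  "finite_fibres S s \<longleftrightarrow> (\<forall>n. finite {x\<in>S. s x = n})"

lemma finite_fibres_subset: "finite_fibres T s \<Longrightarrow> S \<subseteq> T \<Longrightarrow> finite_fibres S s"
  unfolding finite_fibres_def by (auto intro: finite_subset[of "{x \<in> S. s x = n}" "{x \<in> T. s x = n}" for n])

lemma finite_fibres_finite: "finite S \<Longrightarrow> finite_fibres S s"
  by (simp add: finite_fibres_def)

lemma gf_bij_betw:
  assumes "bij_betw h S T"
    and "\<And>x. x \<in> S \<Longrightarrow> s' (h x) = s x" "\<And>x. x \<in> S \<Longrightarrow> w' (h x) = w x"
  shows "gf T s' w' = gf S s w"
proof (rule fps_ext)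
  fix n
  have "bij_betw h {x\<in>S. s x = n} {y\<in>T. s' y = n}"
  proof (rule bij_betw_imageI)
    show "inj_on h {x\<in>S. s x = n}"
      using assms(1) by (auto simp: bij_betw_def inj_on_def)
    have "T = h ` S" using assms(1) by (simp add: bij_betw_def)
    then show "h ` {x\<in>S. s x = n} = {y\<in>T. s' y = n}"
      using assms(2) by auto
  qed
  from sum.reindex_bij_betw[OF this, of w'] show "fps_nth (gf T s' w') n = fps_nth (gf S s w) n"
    using assms(3) by (simp add: gf_def)
qed

lemma gf_cong:
  "S = T \<Longrightarrow> (\<And>x. x \<in> T \<Longrightarrow> s x = s' x) \<Longrightarrow> (\<And>x. x \<in> T \<Longrightarrow> w x = w' x) \<Longrightarrow> gf S s w = gf T s' w'"
  by (simp add: gf_def cong: conj_cong)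

lemma gf_empty [simp]: "gf {} s w = 0"
  by (rule fps_ext) (simp add: gf_def)

lemma gf_Un:
  assumes "finite_fibres S s" "finite_fibres T s" "S \<inter> T = {}"
  shows "gf (S \<union> T) s w = gf S s w + gf T s w"
proof (rule fps_ext)
  fix n
  have "{x \<in> S \<union> T. s x = n} = {x\<in>S. s x = n} \<union> {x\<in>T. s x = n}" by auto
  then show "fps_nth (gf (S \<union> T) s w) n = fps_nth (gf S s w + gf T s w) n"
    using assms by (auto simp: gf_def finite_fibres_def intro!: sum.union_disjoint)
qed

text \<open>The effect of attaching a fixed piece of size \<open>k\<close> and weight
  \<open>c\<close> to every object: one more part, a new largest part, a block of ones, or the 2
  added by \<open>raise_largest\<close>.\<close>

lemma gf_shift: "gf S (\<lambda>x. k + s x) (\<lambda>x. c * w x) = fps_const c * fps_X ^ k * gf S s w"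
proof (rule fps_ext)
  fix n
  have "{x\<in>S. k + s x = n} = (if n < k then {} else {x\<in>S. s x = n - k})" by auto
  then show "fps_nth (gf S (\<lambda>x. k + s x) (\<lambda>x. c * w x)) n
      = fps_nth (fps_const c * fps_X ^ k * gf S s w) n"
    by (simp add: gf_def mult.assoc fps_X_power_mult_nth sum_distrib_left)
qed

lemma gf_singleton: "gf {x} s w = fps_const (w x) * fps_X ^ s x"
  by (rule fps_ext) (auto simp: gf_def fps_X_power_nth Collect_conv_if)

lemma gf_Times:
  assumes "finite_fibres S s" "finite_fibres T s'"
  shows "gf (S \<times> T) (\<lambda>(x, y). s x + s' y) (\<lambda>(x, y). w x * w' y) = gf S s w * gf T s' w'"
proof (rule fps_ext)
  fix n
  let ?P = "\<lambda>i. {x\<in>S. s x = i} \<times> {y\<in>T. s' y = n - i}"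
  have "{z \<in> S \<times> T. (case z of (x, y) \<Rightarrow> s x + s' y) = n} = (\<Union>i\<in>{0..n}. ?P i)"
    by auto
  then have "fps_nth (gf (S \<times> T) (\<lambda>(x, y). s x + s' y) (\<lambda>(x, y). w x * w' y)) n
      = (\<Sum>z\<in>(\<Union>i\<in>{0..n}. ?P i). case z of (x, y) \<Rightarrow> w x * w' y)"
    by (simp add: gf_def)
  also have "\<dots> = (\<Sum>i=0..n. \<Sum>z\<in>?P i. case z of (x, y) \<Rightarrow> w x * w' y)"
    using assms by (intro sum.UNION_disjoint) (auto simp: finite_fibres_def)
  also have "\<dots> = fps_nth (gf S s w * gf T s' w') n"
    by (simp add: fps_mult_nth gf_def sum_product sum.cartesian_product)
  finally show "fps_nth (gf (S \<times> T) (\<lambda>(x, y). s x + s' y) (\<lambda>(x, y). w x * w' y)) n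
      = fps_nth (gf S s w * gf T s' w') n" .
qed

lemma finite_fibres_Times:
  assumes "finite_fibres S s" "finite_fibres T s'"
  shows "finite_fibres (S \<times> T) (\<lambda>(x, y). s x + s' y)"
  unfolding finite_fibres_def
proof
  fix n
  have "{z \<in> S \<times> T. (case z of (x, y) \<Rightarrow> s x + s' y) = n}
      = (\<Union>i\<in>{0..n}. {x\<in>S. s x = i} \<times> {y\<in>T. s' y = n - i})"
    by auto
  then show "finite {z \<in> S \<times> T. (case z of (x, y) \<Rightarrow> s x + s' y) = n}"
    using assms by (simp add: finite_fibres_def)
qed

text \<open>Since \<open>h\<close> is bounded by the size, objects of size \<open>N\<close> lie in
  fibres with index at most \<open>N\<close>, which is where \<open>fps_suminf\<close>
  truncates.\<close>

lemma gf_fibration: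
  assumes "finite_fibres S s" "\<And>x. x \<in> S \<Longrightarrow> h x \<le> s x"
  shows "gf S s w = fps_suminf (\<lambda>n. gf {x\<in>S. h x = n} s w)"
proof (rule fps_ext)
  fix N
  have "(\<Sum>n\<le>N. \<Sum>x\<in>{x \<in> {x\<in>S. s x = N}. h x = n}. w x) = (\<Sum>x\<in>{x\<in>S. s x = N}. w x)"
    using assms by (intro sum.group) (auto simp: finite_fibres_def)
  moreover have "{x \<in> {x\<in>S. s x = N}. h x = n} = {x \<in> {x\<in>S. h x = n}. s x = N}" for n
    by auto
  ultimately show "fps_nth (gf S s w) N = fps_nth (fps_suminf (\<lambda>n. gf {x\<in>S. h x = n} s w)) N"
    by (simp add: gf_def fps_suminf_def)
qed

section \<open>Partitions with prescribed parts\<close>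

text \<open>\<open>M\<close> is the set of allowed positive multiplicities: \<open>UNIV\<close> for arbitrary partitions and
  \<open>{1}\<close> for distinct parts. A part \<open>k\<close> contributes \<open>c k\<close> to the weight and \<open>d * k\<close> to the degree.\<close>

definition parts_in :: "nat set \<Rightarrow> nat set \<Rightarrow> nat multiset set" where
  "parts_in M A = {\<pi>. \<forall>k\<in>#\<pi>. k \<in> A \<and> count \<pi> k \<in> M}"

definition part_gf :: "nat set \<Rightarrow> nat \<Rightarrow> nat set \<Rightarrow> (nat \<Rightarrow> 'a::comm_ring_1) \<Rightarrow> 'a fps" where
  "part_gf M d A c = gf (parts_in M A) (\<lambda>\<pi>. d * \<Sum>\<^sub># \<pi>) (\<lambda>\<pi>. \<Prod>\<^sub># (image_mset c \<pi>))"

lemma le_sum_mset: "k \<in># \<pi> \<Longrightarrow> k \<le> \<Sum>\<^sub># \<pi>" for k :: nat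
  by (induction \<pi>) auto

lemma size_le_sum_mset: "0 \<notin># \<pi> \<Longrightarrow> size \<pi> \<le> \<Sum>\<^sub># \<pi>" for \<pi> :: "nat multiset"
  by (induction \<pi>) (auto simp: neq0_conv)

lemma finite_fibres_partitions:
  assumes "d > 0"
  shows "finite_fibres partitions (\<lambda>\<pi>. d * \<Sum>\<^sub># \<pi>)"
  unfolding finite_fibres_def
proof
  fix n
  have "{\<pi> \<in> partitions. d * \<Sum>\<^sub># \<pi> = n} \<subseteq> (\<Union>k\<le>n. multisets_of_size {..n} k)"
  proof
    fix \<pi> assume "\<pi> \<in> {\<pi> \<in> partitions. d * \<Sum>\<^sub># \<pi> = n}"
    then have "0 \<notin># \<pi>" "d * \<Sum>\<^sub># \<pi> = n" by (auto simp: partitions_def)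
    moreover have "1 * \<Sum>\<^sub># \<pi> \<le> d * \<Sum>\<^sub># \<pi>"
      using assms by (intro mult_le_mono1) simp
    ultimately have "\<Sum>\<^sub># \<pi> \<le> n" by simp
    with size_le_sum_mset[OF \<open>0 \<notin># \<pi>\<close>] le_sum_mset[of _ \<pi>]
    show "\<pi> \<in> (\<Union>k\<le>n. multisets_of_size {..n} k)"
      by (fastforce simp: multisets_of_size_def)
  qed
  then show "finite {\<pi> \<in> partitions. d * \<Sum>\<^sub># \<pi> = n}"
    by (rule finite_subset) auto
qed

lemma finite_fibres_parts_in:
  assumes "d > 0" "0 \<notin> A"
  shows "finite_fibres (parts_in M A) (\<lambda>\<pi>. d * \<Sum>\<^sub># \<pi>)"
  by (rule finite_fibres_subset[OF finite_fibres_partitions[OF assms(1)]])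
     (use assms(2) in \<open>auto simp: parts_in_def partitions_def\<close>)

lemma parts_in_empty: "parts_in M {} = {{#}}"
  by (auto simp: parts_in_def)

lemma part_gf_empty: "part_gf M d {} c = 1"
  by (simp add: part_gf_def parts_in_empty gf_singleton)

text \<open>A partition splits uniquely into its parts in \<open>A\<close> and its parts in
  \<open>B\<close>; disjointness preserves the multiplicities.\<close>

lemma part_gf_Un:
  assumes "d > 0" "0 \<notin> A" "0 \<notin> B" "A \<inter> B = {}"
  shows "part_gf M d (A \<union> B) c = part_gf M d A c * part_gf M d B c"
proof -
  have bij: "bij_betw (\<lambda>(\<alpha>, \<beta>). \<alpha> + \<beta>) (parts_in M A \<times> parts_in M B) (parts_in M (A \<union> B))"
  proof (rule bij_betw_byWitness
      [where f' = "\<lambda>\<pi>. (filter_mset (\<lambda>k. k \<in> A) \<pi>, filter_mset (\<lambda>k. k \<in> B) \<pi>)"])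
    show "\<forall>x\<in>parts_in M A \<times> parts_in M B.
        (case case x of (\<alpha>, \<beta>) \<Rightarrow> \<alpha> + \<beta> of \<pi> \<Rightarrow>
          (filter_mset (\<lambda>k. k \<in> A) \<pi>, filter_mset (\<lambda>k. k \<in> B) \<pi>)) = x"
    proof clarsimp
      fix \<alpha> \<beta> assume ab: "\<alpha> \<in> parts_in M A" "\<beta> \<in> parts_in M B"
      have "filter_mset (\<lambda>k. k \<in> A) \<alpha> = \<alpha>" "filter_mset (\<lambda>k. k \<in> B) \<beta> = \<beta>"
        using ab by (auto simp: filter_mset_eq_conv parts_in_def)
      moreover have "filter_mset (\<lambda>k. k \<in> A) \<beta> = {#}" "filter_mset (\<lambda>k. k \<in> B) \<alpha> = {#}"
        using ab assms(4) by (auto simp: filter_mset_eq_conv parts_in_def)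
      ultimately show "filter_mset (\<lambda>k. k \<in> A) \<alpha> + filter_mset (\<lambda>k. k \<in> A) \<beta> = \<alpha> \<and>
          filter_mset (\<lambda>k. k \<in> B) \<alpha> + filter_mset (\<lambda>k. k \<in> B) \<beta> = \<beta>"
        by simp
    qed
    show "\<forall>\<pi>\<in>parts_in M (A \<union> B).
        (case (filter_mset (\<lambda>k. k \<in> A) \<pi>, filter_mset (\<lambda>k. k \<in> B) \<pi>) of (\<alpha>, \<beta>) \<Rightarrow> \<alpha> + \<beta>) = \<pi>"
      using assms(4) by (auto simp: parts_in_def multiset_eq_iff not_in_iff)
    show "(\<lambda>(\<alpha>, \<beta>). \<alpha> + \<beta>) ` (parts_in M A \<times> parts_in M B) \<subseteq> parts_in M (A \<union> B)"
    proof clarsimp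
      fix \<alpha> \<beta> assume ab: "\<alpha> \<in> parts_in M A" "\<beta> \<in> parts_in M B"
      have "count (\<alpha> + \<beta>) k \<in> M \<and> k \<in> A \<union> B" if "k \<in># \<alpha> + \<beta>" for k
        using ab assms(4) that
        by (cases "k \<in># \<alpha>"; cases "k \<in># \<beta>") (auto simp: parts_in_def not_in_iff)
      then show "\<alpha> + \<beta> \<in> parts_in M (A \<union> B)"
        by (auto simp: parts_in_def)
    qed
    show "(\<lambda>\<pi>. (filter_mset (\<lambda>k. k \<in> A) \<pi>, filter_mset (\<lambda>k. k \<in> B) \<pi>)) ` parts_in M (A \<union> B)
        \<subseteq> parts_in M A \<times> parts_in M B"
      by (auto simp: parts_in_def)
  qed
  have "part_gf M d (A \<union> B) c = gf (parts_in M A \<times> parts_in M B)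
      (\<lambda>(\<alpha>, \<beta>). d * \<Sum>\<^sub># \<alpha> + d * \<Sum>\<^sub># \<beta>)
      (\<lambda>(\<alpha>, \<beta>). \<Prod>\<^sub># (image_mset c \<alpha>) * \<Prod>\<^sub># (image_mset c \<beta>))"
    unfolding part_gf_def by (rule gf_bij_betw[OF bij]) (auto simp: algebra_simps)
  also have "\<dots> = part_gf M d A c * part_gf M d B c"
    unfolding part_gf_def using assms by (intro gf_Times finite_fibres_parts_in)
  finally show ?thesis .
qed

text \<open>The geometric series: a nonempty multiset of copies of \<open>k\<close> is one copy
  added to another such multiset, so the series P satisfies P = 1 + uP with u the term of the part
  \<open>k\<close>.\<close>

lemma part_gf_singleton_UNIV:
  fixes c :: "nat \<Rightarrow> 'a::comm_ring_1"
  assumes "d > 0" "k > 0"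
  shows "part_gf UNIV d {k} c * (1 - fps_const (c k) * fps_X ^ (d * k)) = 1"
proof -
  let ?P = "parts_in UNIV {k}" and ?s = "\<lambda>\<pi>. d * \<Sum>\<^sub># \<pi>"
    and ?w = "\<lambda>\<pi>. \<Prod>\<^sub># (image_mset c \<pi>)"
  have P: "?P = {{#}} \<union> add_mset k ` ?P"
  proof (intro equalityI subsetI)
    fix \<pi> assume \<pi>: "\<pi> \<in> ?P"
    show "\<pi> \<in> {{#}} \<union> add_mset k ` ?P"
    proof (cases \<pi>)
      case (add l \<pi>')
      then show ?thesis using \<pi> by (auto simp: parts_in_def)
    qed simp
  qed (auto simp: parts_in_def)
  have fin: "finite_fibres ?P ?s"
    using assms by (intro finite_fibres_parts_in) auto
  have "part_gf UNIV d {k} c = gf ({{#}} \<union> add_mset k ` ?P) ?s ?w"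
    unfolding part_gf_def by (rule gf_cong[OF P refl refl])
  also have "\<dots> = gf {{#}} ?s ?w + gf (add_mset k ` ?P) ?s ?w"
  proof (rule gf_Un)
    show "finite_fibres (add_mset k ` ?P) ?s"
      using P by (intro finite_fibres_subset[OF fin]) blast
  qed (auto simp: finite_fibres_finite)
  also have "gf (add_mset k ` ?P) ?s ?w = gf ?P (\<lambda>\<pi>. d * k + ?s \<pi>) (\<lambda>\<pi>. c k * ?w \<pi>)"
    by (rule gf_bij_betw[of "add_mset k"]) (auto simp: bij_betw_def inj_on_def add_mult_distrib2)
  also have "\<dots> = fps_const (c k) * fps_X ^ (d * k) * part_gf UNIV d {k} c"
    unfolding part_gf_def by (rule gf_shift)
  also have "gf {{#}} ?s ?w = 1"
    by (simp add: gf_singleton)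
  finally have "part_gf UNIV d {k} c = 1 + fps_const (c k) * fps_X ^ (d * k) * part_gf UNIV d {k} c" .
  then have "part_gf UNIV d {k} c - part_gf UNIV d {k} c * (fps_const (c k) * fps_X ^ (d * k)) = 1"
    by (metis add_diff_cancel_right' mult.commute)
  then show ?thesis by (simp only: right_diff_distrib mult_1_right)
qed

lemma part_gf_singleton_distinct:
  fixes c :: "nat \<Rightarrow> 'a::comm_ring_1"
  shows "part_gf {1} d {k} c = 1 + fps_const (c k) * fps_X ^ (d * k)"
proof -
  have "parts_in {1} {k} = {{#}} \<union> {{#k#}}"
  proof (intro equalityI subsetI)
    fix \<pi> assume \<pi>: "\<pi> \<in> parts_in {1} {k}"
    show "\<pi> \<in> {{#}} \<union> {{#k#}}"
    proof (cases "\<pi> = {#}")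
      case False
      then obtain j where "j \<in># \<pi>" by blast
      with \<pi> have k: "count \<pi> k = 1" by (auto simp: parts_in_def)
      have "count \<pi> j = 0" if "j \<noteq> k" for j
        using \<pi> that by (auto simp: parts_in_def simp flip: not_in_iff)
      with k have "count \<pi> j = count {#k#} j" for j
        by (cases "j = k") auto
      then show ?thesis by (simp add: multiset_eq_iff)
    qed simp
  qed (auto simp: parts_in_def)
  then have "part_gf {1} d {k} c
      = gf ({{#}} \<union> {{#k#}}) (\<lambda>\<pi>. d * \<Sum>\<^sub># \<pi>) (\<lambda>\<pi>. \<Prod>\<^sub># (image_mset c \<pi>))"
    unfolding part_gf_def by simp
  also have "\<dots> = 1 + fps_const (c k) * fps_X ^ (d * k)"
    by (subst gf_Un) (auto simp: finite_fibres_finite gf_singleton)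
  finally show ?thesis .
qed

text \<open>A nonempty partition whose parts all exceed \<open>N\<close> has size above
  \<open>N\<close>, so only the empty partition survives in low degrees.\<close>

lemma part_gf_tail_LIMSEQ:
  fixes c :: "nat \<Rightarrow> 'a::comm_ring_1"
  assumes "d > 0" "\<And>N k. k \<in> A N \<Longrightarrow> N < k"
  shows "(\<lambda>N. part_gf M d (A N) c) \<longlonglongrightarrow> 1"
proof (rule tendsto_fpsI)
  fix n
  show "eventually (\<lambda>N. fps_nth (part_gf M d (A N) c) n = fps_nth 1 n) sequentially"
    using eventually_ge_at_top[of n]
  proof eventually_elim
    case (elim N)
    have "n < d * \<Sum>\<^sub># \<pi>" if "\<pi> \<in> parts_in M (A N)" "\<pi> \<noteq> {#}" for \<pi>
    proof -
      obtain k where k: "k \<in># \<pi>" using \<open>\<pi> \<noteq> {#}\<close> by blast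
      have "N < k" using assms(2) k that(1) by (auto simp: parts_in_def)
      moreover have "1 * \<Sum>\<^sub># \<pi> \<le> d * \<Sum>\<^sub># \<pi>"
        using assms(1) by (intro mult_le_mono1) simp
      ultimately show ?thesis using elim le_sum_mset[OF k] by linarith
    qed
    moreover have "{#} \<in> parts_in M (A N)" by (simp add: parts_in_def)
    ultimately have "\<pi> \<in> parts_in M (A N) \<and> d * \<Sum>\<^sub># \<pi> = n \<longleftrightarrow> n = 0 \<and> \<pi> = {#}" for \<pi>
      by (cases "\<pi> = {#}") (auto dest: less_not_refl2)
    then have "{\<pi> \<in> parts_in M (A N). d * \<Sum>\<^sub># \<pi> = n} = (if n = 0 then {{#}} else {})"
      by auto
    then show ?case by (simp add: part_gf_def gf_def)
  qed
qed

text \<open>The parts are listed by a function \<open>g\<close>, so that the product over the parts becomes a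
  \<open>q\<close>-Pochhammer symbol.\<close>

lemma part_gf_image_step:
  assumes "d > 0" "inj g" "\<And>k. k < g k"
  shows "part_gf M d (g ` {K..}) c = part_gf M d {g K} c * part_gf M d (g ` {Suc K..}) c"
proof -
  have g_K: "g ` {K..} = {g K} \<union> g ` {Suc K..}"
    by (metis atLeast_Suc_greaterThan image_insert insert_is_Un ivl_disj_un_singleton(1))
  moreover have "0 \<notin> range g"
    using assms(3)[THEN gr_implies_not0] by (metis rangeE)
  moreover have "{g K} \<inter> g ` {Suc K..} = {}"
    using assms(2) by (auto simp: inj_eq)
  ultimately show ?thesis
    unfolding g_K using assms(1) by (intro part_gf_Un) auto
qed

text \<open>Each factor cancels the geometric series of one part. The finite form is kept because
  the crank expansion multiplies by partial products as well.\<close>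

lemma part_gf_prod:
  assumes "d > 0" "inj g" "\<And>k. k < g k"
  shows "part_gf UNIV d (range g) c * (\<Prod>k<K. 1 - fps_const (c (g k)) * fps_X ^ (d * g k))
    = part_gf UNIV d (g ` {K..}) c"
proof (induction K)
  case 0
  have "{0::nat..} = UNIV" by auto
  then show ?case by simp
next
  case (Suc K)
  let ?u = "1 - fps_const (c (g K)) * fps_X ^ (d * g K)"
  have "part_gf UNIV d (range g) c * (\<Prod>k<Suc K. 1 - fps_const (c (g k)) * fps_X ^ (d * g k))
      = part_gf UNIV d (g ` {K..}) c * ?u"
    by (simp flip: Suc add: mult.assoc)
  also have "\<dots> = part_gf UNIV d {g K} c * ?u * part_gf UNIV d (g ` {Suc K..}) c"
    by (subst part_gf_image_step[OF assms]) (simp only: mult_ac)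
  also have "part_gf UNIV d {g K} c * ?u = 1"
    using assms(1) assms(3)[of K] by (intro part_gf_singleton_UNIV) auto
  finally show ?case by simp
qed

text \<open>The limit of \<open>part_gf_prod\<close>: the condition \<open>k < g k\<close> pushes
  the remaining parts to infinity, so the right-hand sides tend to 1.\<close>

lemma part_gf_mult_qpoch_inf:
  assumes "d > 0" "inj g" "\<And>k. k < g k" "fps_nth a 0 = 0" "fps_nth q 0 = 0"
    and "\<And>k. a * q ^ k = fps_const (c (g k)) * fps_X ^ (d * g k)"
  shows "part_gf UNIV d (range g) c * qpoch_inf a q = 1"
proof (rule LIMSEQ_unique)
  show "(\<lambda>K. part_gf UNIV d (range g) c * (\<Prod>k<K. 1 - a * q ^ k))
      \<longlonglongrightarrow> part_gf UNIV d (range g) c * qpoch_inf a q"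
    using assms by (intro fps_tendsto_mult tendsto_const qpoch_inf_LIMSEQ)
  have "(\<lambda>K. part_gf UNIV d (g ` {K..}) c) \<longlonglongrightarrow> 1"
    using assms by (intro part_gf_tail_LIMSEQ) (auto intro: le_less_trans)
  then show "(\<lambda>K. part_gf UNIV d (range g) c * (\<Prod>k<K. 1 - a * q ^ k)) \<longlonglongrightarrow> 1"
    using assms by (simp add: part_gf_prod)
qed

lemma qpoch_inf_eq_distinct_part_gf:
  assumes "d > 0" "inj g" "\<And>k. k < g k" "fps_nth a 0 = 0" "fps_nth q 0 = 0"
    and a: "\<And>k. - a * q ^ k = fps_const (c (g k)) * fps_X ^ (d * g k)"
  shows "qpoch_inf a q = part_gf {1} d (range g) c"
proof -
  \<comment> \<open>The partial product accounts for the parts \<open>g k\<close> with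
    \<open>k < K\<close>, the second factor for the others, so the value does not depend on
    \<open>K\<close>.\<close>
  have prod: "(\<Prod>k<K. 1 - a * q ^ k) * part_gf {1} d (g ` {K..}) c = part_gf {1} d (range g) c" for K
  proof (induction K)
    case 0
    have "{0::nat..} = UNIV" by auto
    then show ?case by simp
  next
    case (Suc K)
    have "1 - a * q ^ K = part_gf {1} d {g K} c"
      unfolding part_gf_singleton_distinct a[symmetric] by simp
    then show ?case
      using Suc by (simp add: part_gf_image_step[OF assms(1-3), of _ K] mult.assoc)
  qed
  have "(\<lambda>K. part_gf {1} d (g ` {K..}) c) \<longlonglongrightarrow> 1"
    using assms by (intro part_gf_tail_LIMSEQ) (auto intro: le_less_trans)
  then have "(\<lambda>K. (\<Prod>k<K. 1 - a * q ^ k) * part_gf {1} d (g ` {K..}) c) \<longlonglongrightarrow> qpoch_inf a q * 1"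
    using assms by (intro fps_tendsto_mult qpoch_inf_LIMSEQ)
  then show ?thesis
    unfolding prod using LIMSEQ_unique[OF tendsto_const] by fastforce
qed

section \<open>The generating function of the crank\<close>

lemma qpoch_inf_0: "fps_nth q 0 = 0 \<Longrightarrow> qpoch_inf 0 q = 1"
  using qpoch_inf_LIMSEQ[of 0 q] by (simp add: LIMSEQ_const_iff)

lemma qpoch_inf_unfold:
  assumes "fps_nth a 0 = 0" "fps_nth q 0 = 0"
  shows "qpoch_inf a q = (1 - a) * qpoch_inf (a * q) q"
proof (rule LIMSEQ_unique)
  show "(\<lambda>N. \<Prod>k<Suc N. 1 - a * q ^ k) \<longlonglongrightarrow> qpoch_inf a q"
    using qpoch_inf_LIMSEQ[OF assms] by (rule LIMSEQ_Suc)
  have "(\<lambda>N. (1 - a) * (\<Prod>k<N. 1 - a * q * q ^ k)) \<longlonglongrightarrow> (1 - a) * qpoch_inf (a * q) q"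
    using assms by (intro fps_tendsto_mult tendsto_const qpoch_inf_LIMSEQ) simp_all
  then show "(\<lambda>N. \<Prod>k<Suc N. 1 - a * q ^ k) \<longlonglongrightarrow> (1 - a) * qpoch_inf (a * q) q"
    by (simp add: prod.lessThan_Suc_shift mult.assoc del: prod.lessThan_Suc)
qed

text \<open>This makes the fibres admissible summands for \<open>fps_suminf\<close>.\<close>

lemma gf_fibre_nth_eq_0:
  assumes "\<And>x. x \<in> S \<Longrightarrow> h x \<le> s x" "N < n"
  shows "fps_nth (gf {x\<in>S. h x = n} s w) N = 0"
proof -
  have "{x \<in> {x\<in>S. h x = n}. s x = N} = {}" using assms by fastforce
  then show ?thesis by (simp only: gf_def fps_nth_Abs_fps sum.empty)
qed

section \<open>Monomials in z and partitions with bounded parts\<close>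

abbreviation zw :: "int \<Rightarrow> laurent_poly" where
  "zw m \<equiv> Poly_Mapping.single m 1"

lemma zw_0: "zw 0 = 1"
  by (simp add: single_one)

lemma zw_add: "zw (i + j) = zw i * zw j"
  by (simp add: mult_single)

lemma zpow_mult: "zpow i * zpow j = zpow (i + j)"
  by (simp add: zpow_def zw_add)

lemma zpow_power: "zpow i ^ n = fps_const (zw (i * int n))"
  by (induction n) (simp_all add: zpow_def zw_add zw_0 algebra_simps)

lemma prod_mset_zw: "\<Prod>\<^sub># (image_mset (\<lambda>_. zw 1) \<pi>) = zw (int (size \<pi>))"
  by (induction \<pi>) (simp_all add: zw_0 flip: zw_add)

text \<open>The reciprocal of the finite product (Q;Q)_n, where Q is
  \<open>fps_X ^ d\<close>.\<close>

definition parts_upto_gf :: "nat \<Rightarrow> nat \<Rightarrow> laurent_poly fps" where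
  "parts_upto_gf d n = part_gf UNIV d {1..n} (\<lambda>_. 1)"

definition noones_upto_gf :: "nat \<Rightarrow> nat \<Rightarrow> laurent_poly fps" where
  "noones_upto_gf d n = part_gf UNIV d {2..n} (\<lambda>_. 1)"

lemma parts_upto_gf_0: "parts_upto_gf d 0 = 1"
  by (simp add: parts_upto_gf_def part_gf_empty)

lemma part_gf_insert_mult:
  fixes c :: "nat \<Rightarrow> 'a::comm_ring_1"
  assumes "d > 0" "k > 0" "0 \<notin> A" "k \<notin> A"
  shows "part_gf UNIV d (insert k A) c * (1 - fps_const (c k) * fps_X ^ (d * k)) = part_gf UNIV d A c"
proof -
  have "part_gf UNIV d (insert k A) c = part_gf UNIV d ({k} \<union> A) c" by simp
  also have "\<dots> = part_gf UNIV d {k} c * part_gf UNIV d A c"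
    using assms by (intro part_gf_Un) auto
  finally have "part_gf UNIV d (insert k A) c * (1 - fps_const (c k) * fps_X ^ (d * k))
     = part_gf UNIV d {k} c * (1 - fps_const (c k) * fps_X ^ (d * k)) * part_gf UNIV d A c"
    by (simp add: mult_ac)
  then show ?thesis using part_gf_singleton_UNIV[OF assms(1,2), of c] by simp
qed

lemma parts_upto_gf_Suc:
  assumes "d > 0"
  shows "parts_upto_gf d (Suc n) * (1 - (fps_X ^ d) ^ Suc n) = parts_upto_gf d n"
proof -
  have "{1..Suc n} = insert (Suc n) {1..n}" by auto
  then show ?thesis
    using part_gf_insert_mult[OF assms, of "Suc n" "{1..n}" "\<lambda>_. 1"]
    by (simp add: parts_upto_gf_def power_add power_mult)
qed

text \<open>Multiplication by \<open>1 - fps_X ^ d\<close> forbids the part 1. At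
  \<open>n = 0\<close> there is no part 1 to forbid: the two sides would be
  \<open>1 - fps_X ^ d\<close> and 1, which is where the anomalous \<open>- fps_X ^ d\<close> comes
  from.\<close>

lemma noones_upto_gf_eq:
  assumes "d > 0" "n > 0"
  shows "(1 - fps_X ^ d) * parts_upto_gf d n = noones_upto_gf d n"
proof -
  have "{1..n} = insert 1 {2..n}" using assms by auto
  then show ?thesis
    using part_gf_insert_mult[OF assms(1), of 1 "{2..n}" "\<lambda>_. 1"]
    by (simp add: parts_upto_gf_def noones_upto_gf_def mult.commute)
qed

lemma part_gf_zw_mult_qpoch_inf:
  assumes "d > 0"
  shows "part_gf UNIV d {0<..} (\<lambda>_. zw 1) * qpoch_inf (zpow 1 * fps_X ^ d) (fps_X ^ d) = 1"
proof -
  have "range Suc = {0<..}" by (auto simp: image_iff gr0_conv_Suc)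
  moreover have "part_gf UNIV d (range Suc) (\<lambda>_. zw 1)
      * qpoch_inf (zpow 1 * fps_X ^ d) (fps_X ^ d) = 1"
    using assms by (intro part_gf_mult_qpoch_inf)
      (auto simp: zpow_def power_add power_mult mult.assoc fps_X_power_nth)
  ultimately show ?thesis by simp
qed

text \<open>The product deletes the parts up to \<open>K\<close>; those left are the ones that
  \<open>mu\<close> counts in a partition with \<open>K\<close> ones.\<close>

lemma part_gf_zw_mult_prod:
  assumes "d > 0"
  shows "part_gf UNIV d {0<..} (\<lambda>_. zw 1) * (\<Prod>k<K. 1 - zpow 1 * fps_X ^ d * (fps_X ^ d) ^ k)
    = part_gf UNIV d {K<..} (\<lambda>_. zw 1)"
proof -
  have im: "Suc ` {K..} = {K<..}" for K
    by (auto simp: image_iff Suc_le_eq dest: less_imp_Suc_add)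
  have "{0::nat..} = UNIV" by auto
  then have "range Suc = {0<..}" using im[of 0] by simp
  then show ?thesis
    using part_gf_prod[OF assms, of Suc "\<lambda>_. zw 1" K]
    by (simp add: im zpow_def power_add power_mult mult.assoc)
qed

text \<open>Euler's identity, the case \<open>a = 0\<close> of the \<open>q\<close>-binomial theorem. It replaces conjugation of
  partitions: the left-hand side counts parts, the right-hand side is graded by the largest part.\<close>

lemma euler_largest:
  assumes "d > 0"
  shows "part_gf UNIV d {0<..} (\<lambda>_. zw 1)
    = fps_suminf (\<lambda>n. parts_upto_gf d n * (zpow 1 * fps_X ^ d) ^ n)"
proof -
  let ?P = "qpoch_inf (zpow 1 * fps_X ^ d) (fps_X ^ d)"
  let ?Z = "part_gf UNIV d {0<..} (\<lambda>_. zw 1)"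
  let ?E = "fps_suminf (\<lambda>n. parts_upto_gf d n * (zpow 1 * fps_X ^ d) ^ n)"
  have E: "?E * ?P = 1"
    using q_binomial[of "parts_upto_gf d" "fps_X ^ d" 0 "zpow 1 * fps_X ^ d"] assms
    by (simp add: parts_upto_gf_0 parts_upto_gf_Suc qpoch_inf_0 del: power_Suc)
  \<comment> \<open>Both \<open>?Z\<close> and \<open>?E\<close> are inverses of \<open>?P\<close>,
    hence equal.\<close>
  have "?Z = ?Z * (?E * ?P)" unfolding E by simp
  also have "\<dots> = (?Z * ?P) * ?E" by (simp only: mult_ac)
  also have "\<dots> = ?E" unfolding part_gf_zw_mult_qpoch_inf[OF assms] by simp
  finally show ?thesis .
qed

text \<open>The crank product sorted by the number of ones. The first summand is the case without
  ones, with z still marking the number of parts; in the sum, \<open>Suc n\<close> is the number of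
  ones.\<close>

definition crank_series :: "nat \<Rightarrow> laurent_poly fps" where
  "crank_series d = (1 - fps_X ^ d) * part_gf UNIV d {0<..} (\<lambda>_. zw 1) +
     fps_suminf (\<lambda>n. noones_upto_gf d (Suc n) * part_gf UNIV d {Suc n<..} (\<lambda>_. zw 1)
       * (zpow (-1) * fps_X ^ d) ^ Suc n)"

lemma crank_series_mult:
  assumes "d > 0"
  shows "crank_series d * (qpoch_inf (zpow 1 * fps_X ^ d) (fps_X ^ d)
      * qpoch_inf (zpow (-1) * fps_X ^ d) (fps_X ^ d)) = qpoch_inf (fps_X ^ d) (fps_X ^ d)"
proof -
  let ?Q = "fps_X ^ d :: laurent_poly fps"
  let ?t = "zpow (-1) * ?Q"
  let ?Z = "part_gf UNIV d {0<..} (\<lambda>_. zw 1)"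
  let ?P = "qpoch_inf (zpow 1 * ?Q) ?Q" and ?P' = "qpoch_inf ?t ?Q"
  \<comment> \<open>\<open>a n\<close> is (zQ;Q)_n, so \<open>a n * parts_upto_gf d n\<close> is the
    q-binomial coefficient (zQ;Q)_n / (Q;Q)_n.\<close>
  define a where "a n = (\<Prod>k<n. 1 - zpow 1 * ?Q * ?Q ^ k)" for n
  define F where "F = fps_suminf (\<lambda>n. a n * parts_upto_gf d n * ?t ^ n)"
  have Q0: "fps_nth ?Q 0 = 0" and t0: "fps_nth ?t 0 = 0" using assms by simp_all
  have tQ: "zpow 1 * ?Q * ?t = ?Q * ?Q"
  proof -
    have "zpow 1 * ?Q * ?t = (zpow 1 * zpow (-1)) * (?Q * ?Q)" by (simp only: mult_ac)
    also have "zpow 1 * zpow (-1) = 1" unfolding zpow_mult by (simp add: zpow_def zw_0)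
    finally show ?thesis by simp
  qed
  have F: "F * ?P' = qpoch_inf (?Q * ?Q) ?Q"
    unfolding F_def tQ[symmetric]
  proof (rule q_binomial[OF _ _ t0 Q0])
    show "a 0 * parts_upto_gf d 0 = 1" by (simp add: a_def parts_upto_gf_0)
    show "a (Suc n) * parts_upto_gf d (Suc n) * (1 - ?Q ^ Suc n)
        = a n * parts_upto_gf d n * (1 - zpow 1 * ?Q * ?Q ^ n)" for n
    proof -
      have "a (Suc n) = a n * (1 - zpow 1 * ?Q * ?Q ^ n)"
        by (simp add: a_def)
      then show ?thesis
        using parts_upto_gf_Suc[OF assms, of n] by (simp only: mult.assoc) (simp only: mult_ac)
    qed
  qed
  \<comment> \<open>In each summand \<open>1 - ?Q\<close> is absorbed by the bounded parts and
    \<open>?Z\<close> by \<open>a\<close>; the summand 0 is split off because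
    \<open>noones_upto_gf_eq\<close> fails there.\<close>
  have "(1 - ?Q) * ?Z * F = crank_series d"
  proof -
    have "(1 - ?Q) * ?Z * F
        = fps_suminf (\<lambda>n. (1 - ?Q) * ?Z * (a n * parts_upto_gf d n * ?t ^ n))"
      unfolding F_def by (rule fps_suminf_mult_left[symmetric]) (rule nth_mult_power_eq_0[OF t0])
    also have "\<dots> = (1 - ?Q) * ?Z * (a 0 * parts_upto_gf d 0 * ?t ^ 0)
        + fps_suminf (\<lambda>n. (1 - ?Q) * ?Z * (a (Suc n) * parts_upto_gf d (Suc n) * ?t ^ Suc n))"
      unfolding mult.assoc[symmetric]
      by (rule fps_suminf_Suc) (rule nth_mult_power_eq_0[OF t0])
    also have "(\<lambda>n. (1 - ?Q) * ?Z * (a (Suc n) * parts_upto_gf d (Suc n) * ?t ^ Suc n))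
        = (\<lambda>n. noones_upto_gf d (Suc n) * part_gf UNIV d {Suc n<..} (\<lambda>_. zw 1) * ?t ^ Suc n)"
    proof
      fix n
      have "(1 - ?Q) * ?Z * (a (Suc n) * parts_upto_gf d (Suc n) * ?t ^ Suc n)
          = ((1 - ?Q) * parts_upto_gf d (Suc n)) * (?Z * a (Suc n)) * ?t ^ Suc n"
        by (simp only: mult_ac)
      also have "(1 - ?Q) * parts_upto_gf d (Suc n) = noones_upto_gf d (Suc n)"
        using assms by (simp add: noones_upto_gf_eq)
      also have "?Z * a (Suc n) = part_gf UNIV d {Suc n<..} (\<lambda>_. zw 1)"
        unfolding a_def by (rule part_gf_zw_mult_prod[OF assms])
      finally show "(1 - ?Q) * ?Z * (a (Suc n) * parts_upto_gf d (Suc n) * ?t ^ Suc n)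
          = noones_upto_gf d (Suc n) * part_gf UNIV d {Suc n<..} (\<lambda>_. zw 1) * ?t ^ Suc n" .
    qed
    finally show ?thesis by (simp add: crank_series_def a_def parts_upto_gf_0)
  qed
  then have "crank_series d * (?P * ?P') = (1 - ?Q) * (?Z * ?P) * (F * ?P')"
    by (simp only: mult_ac flip: \<open>(1 - ?Q) * ?Z * F = crank_series d\<close>)
  also have "\<dots> = (1 - ?Q) * qpoch_inf (?Q * ?Q) ?Q"
    unfolding F part_gf_zw_mult_qpoch_inf[OF assms] by simp
  also have "\<dots> = qpoch_inf ?Q ?Q"
    by (rule qpoch_inf_unfold[symmetric]) (use Q0 in auto)
  finally show ?thesis .
qed

section \<open>Combinatorial reading of the crank series\<close>

lemma largest_add_mset:
  assumes "\<pi> \<in> parts_in M {k..n}"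
  shows "largest (add_mset n \<pi>) = n"
  unfolding largest_def
  by (rule Max_eqI) (use assms in \<open>auto simp: parts_in_def\<close>)

lemma largest_in: "\<pi> \<noteq> {#} \<Longrightarrow> largest \<pi> \<in># \<pi>"
  unfolding largest_def by (rule Max_in) auto

lemma le_largest: "k \<in># \<pi> \<Longrightarrow> k \<le> largest \<pi>"
  unfolding largest_def by (rule Max_ge) auto

text \<open>By \<open>euler_largest\<close> the left-hand side is graded by the largest part. From
  index 2 on, its terms are the partitions without ones with that largest part, and their crank is
  the index. The terms of index 0 and 1, namely \<open>1 - fps_X ^ d\<close> and
  \<open>zpow 1 * fps_X ^ d\<close>, match no nonempty partition without ones.\<close>

lemma crank_gf_no_ones:
  assumes "d > 0"
  shows "(1 - fps_X ^ d) * part_gf UNIV d {0<..} (\<lambda>_. zw 1)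
    = 1 - fps_X ^ d + zpow 1 * fps_X ^ d
      + gf {\<pi>\<in>partitions. \<pi> \<noteq> {#} \<and> ones \<pi> = 0} (\<lambda>\<pi>. d * \<Sum>\<^sub># \<pi>) (\<lambda>\<pi>. zw (crank \<pi>))"
    (is "_ = _ + gf ?S ?s ?w")
proof -
  let ?Q = "fps_X ^ d :: laurent_poly fps"
  let ?t = "zpow 1 * ?Q"
  define f where "f n = gf {\<pi>\<in>?S. largest \<pi> = n} ?s ?w" for n
  have t0: "fps_nth ?t 0 = 0" using assms by simp
  have fin: "finite_fibres ?S ?s"
    by (rule finite_fibres_subset[OF finite_fibres_partitions[OF assms]]) auto
  have le: "largest \<pi> \<le> ?s \<pi>" if "\<pi> \<in> ?S" for \<pi>
  proof -
    have "1 * \<Sum>\<^sub># \<pi> \<le> d * \<Sum>\<^sub># \<pi>" using assms by (intro mult_le_mono1) simp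
    moreover have "largest \<pi> \<le> \<Sum>\<^sub># \<pi>" using that by (intro le_sum_mset largest_in) auto
    ultimately show ?thesis by linarith
  qed
  have f_low: "fps_nth (f n) N = 0" if "N < n" for n N
    unfolding f_def by (rule gf_fibre_nth_eq_0[OF le that])
  have ge2: "2 \<le> k" if "\<pi> \<in> ?S" "k \<in># \<pi>" for \<pi> k
  proof -
    have "k \<noteq> 0" using that by (metis (mono_tags, lifting) mem_Collect_eq partitions_def)
    moreover have "k \<noteq> 1" using that by (auto simp: ones_def count_eq_zero_iff)
    ultimately show ?thesis by simp
  qed
  have f01: "f n = 0" if "n < 2" for n
  proof -
    have "largest \<pi> \<noteq> n" if "\<pi> \<in> ?S" for \<pi>
      using ge2[OF that largest_in] that \<open>n < 2\<close> by auto
    then have "{\<pi>\<in>?S. largest \<pi> = n} = {}" by blast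
    then show ?thesis by (simp only: f_def gf_empty)
  qed
  \<comment> \<open>Removing one copy of the largest part leaves an arbitrary partition into parts
    from 2 up to that part.\<close>
  have f2: "f (Suc (Suc n)) = noones_upto_gf d (Suc (Suc n)) * ?t ^ Suc (Suc n)" for n
  proof -
    let ?m = "Suc (Suc n)"
    have bij: "bij_betw (add_mset ?m) (parts_in UNIV {2..?m}) {\<pi>\<in>?S. largest \<pi> = ?m}"
    proof (rule bij_betwI[where g = "\<lambda>\<pi>. \<pi> - {#?m#}"])
      show "add_mset ?m \<in> parts_in UNIV {2..?m} \<rightarrow> {\<pi>\<in>?S. largest \<pi> = ?m}"
        by (auto simp: largest_add_mset partitions_def ones_def count_eq_zero_iff)
           (auto simp: parts_in_def)
      show "(\<lambda>\<pi>. \<pi> - {#?m#}) \<in> {\<pi>\<in>?S. largest \<pi> = ?m} \<rightarrow> parts_in UNIV {2..?m}"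
        using ge2 le_largest by (fastforce simp: parts_in_def dest: in_diffD)
      show "add_mset ?m (\<pi> - {#?m#}) = \<pi>" if "\<pi> \<in> {\<pi>\<in>?S. largest \<pi> = ?m}" for \<pi>
        using that largest_in[of \<pi>] by auto
    qed simp
    have "f ?m = gf (parts_in UNIV {2..?m}) (\<lambda>\<pi>. d * ?m + ?s \<pi>)
        (\<lambda>\<pi>. zw (int ?m) * \<Prod>\<^sub># (image_mset (\<lambda>_. 1) \<pi>))"
      unfolding f_def
    proof (rule gf_bij_betw[OF bij])
      fix \<pi> assume "\<pi> \<in> parts_in UNIV {2..?m}"
      then have "add_mset ?m \<pi> \<in> {\<pi>\<in>?S. largest \<pi> = ?m}"
        using bij by (auto simp: bij_betw_def)
      then show "zw (crank (add_mset ?m \<pi>)) = zw (int ?m) * \<Prod>\<^sub># (image_mset (\<lambda>_. 1) \<pi>)"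
        by (simp add: crank_def)
    qed (simp add: algebra_simps)
    also have "\<dots> = fps_const (zw (int ?m)) * fps_X ^ (d * ?m) * noones_upto_gf d ?m"
      unfolding gf_shift noones_upto_gf_def part_gf_def by (rule refl)
    also have "fps_const (zw (int ?m)) * fps_X ^ (d * ?m) = ?t ^ ?m"
      unfolding power_mult_distrib zpow_power power_mult by simp
    finally show ?thesis by (simp only: mult.commute)
  qed
  have "gf ?S ?s ?w = fps_suminf f"
    unfolding f_def by (rule gf_fibration[OF fin le])
  also have "\<dots> = f 0 + fps_suminf (\<lambda>n. f (Suc n))"
    by (rule fps_suminf_Suc) (rule f_low)
  also have "fps_suminf (\<lambda>n. f (Suc n)) = f (Suc 0) + fps_suminf (\<lambda>n. f (Suc (Suc n)))"
    by (rule fps_suminf_Suc) (use f_low in auto)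
  also have "f 0 + (f (Suc 0) + fps_suminf (\<lambda>n. f (Suc (Suc n))))
      = fps_suminf (\<lambda>n. noones_upto_gf d (Suc (Suc n)) * ?t ^ Suc (Suc n))"
    unfolding f2 using f01[of 0] f01[of "Suc 0"] by simp
  finally have gf: "gf ?S ?s ?w
      = fps_suminf (\<lambda>n. noones_upto_gf d (Suc (Suc n)) * ?t ^ Suc (Suc n))" .
  have low: "fps_nth (g n * ?t ^ n) N = 0" if "N < n" for n N g
    by (rule nth_mult_power_eq_0[OF t0 that])
  have low': "fps_nth (g n * ?t ^ Suc n) N = 0" if "N < n" for n N g
    by (rule nth_mult_power_eq_0[OF t0]) (use that in simp)
  have "(1 - ?Q) * part_gf UNIV d {0<..} (\<lambda>_. zw 1)
      = fps_suminf (\<lambda>n. (1 - ?Q) * parts_upto_gf d n * ?t ^ n)"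
    unfolding euler_largest[OF assms] mult.assoc
    by (rule fps_suminf_mult_left[symmetric]) (rule low)
  also have "\<dots> = (1 - ?Q) * parts_upto_gf d 0 * ?t ^ 0
      + fps_suminf (\<lambda>n. (1 - ?Q) * parts_upto_gf d (Suc n) * ?t ^ Suc n)"
    by (rule fps_suminf_Suc) (rule low)
  also have "fps_suminf (\<lambda>n. (1 - ?Q) * parts_upto_gf d (Suc n) * ?t ^ Suc n)
      = (1 - ?Q) * parts_upto_gf d (Suc 0) * ?t ^ Suc 0
       + fps_suminf (\<lambda>n. (1 - ?Q) * parts_upto_gf d (Suc (Suc n)) * ?t ^ Suc (Suc n))"
    by (rule fps_suminf_Suc) (rule low')
  \<comment> \<open>The range \<open>{2..1}\<close> of allowed parts is empty.\<close>
  also have "(1 - ?Q) * parts_upto_gf d (Suc 0) = 1"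
    using noones_upto_gf_eq[OF assms, of 1] by (simp add: noones_upto_gf_def part_gf_empty)
  also have "(\<lambda>n. (1 - ?Q) * parts_upto_gf d (Suc (Suc n)) * ?t ^ Suc (Suc n))
      = (\<lambda>n. noones_upto_gf d (Suc (Suc n)) * ?t ^ Suc (Suc n))"
    using noones_upto_gf_eq[OF assms] by simp
  finally show ?thesis
    unfolding gf by (simp add: parts_upto_gf_0)
qed

text \<open>Given \<open>n > 0\<close> ones, the other parts split into those up to
  \<open>n\<close>, which the crank ignores, and those above \<open>n\<close>, each of which adds 1
  to it; every one subtracts 1.\<close>

lemma crank_gf_ones:
  assumes "d > 0"
  shows "gf {\<pi>\<in>partitions. ones \<pi> > 0} (\<lambda>\<pi>. d * \<Sum>\<^sub># \<pi>) (\<lambda>\<pi>. zw (crank \<pi>))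
    = fps_suminf (\<lambda>n. noones_upto_gf d (Suc n) * part_gf UNIV d {Suc n<..} (\<lambda>_. zw 1)
       * (zpow (-1) * fps_X ^ d) ^ Suc n)"
    (is "gf ?S ?s ?w = _")
proof -
  let ?t = "zpow (-1) * fps_X ^ d :: laurent_poly fps"
  define f where "f n = gf {\<pi>\<in>?S. ones \<pi> = n} ?s ?w" for n
  have fin: "finite_fibres ?S ?s"
    by (rule finite_fibres_subset[OF finite_fibres_partitions[OF assms]]) auto
  have le: "ones \<pi> \<le> ?s \<pi>" if "\<pi> \<in> ?S" for \<pi>
  proof -
    have "1 * \<Sum>\<^sub># \<pi> \<le> d * \<Sum>\<^sub># \<pi>" using assms by (intro mult_le_mono1) simp
    moreover have "size \<pi> \<le> \<Sum>\<^sub># \<pi>" using that by (auto simp: partitions_def size_le_sum_mset)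
    ultimately show ?thesis using count_le_size[of \<pi> 1] unfolding ones_def by linarith
  qed
  have f_low: "fps_nth (f n) N = 0" if "N < n" for n N
    unfolding f_def by (rule gf_fibre_nth_eq_0[OF le that])
  have "{\<pi>\<in>?S. ones \<pi> = 0} = {}" by auto
  then have f0: "f 0 = 0" by (simp only: f_def gf_empty)
  have fS: "f (Suc n) = noones_upto_gf d (Suc n) * part_gf UNIV d {Suc n<..} (\<lambda>_. zw 1) * ?t ^ Suc n"
    for n
  proof -
    let ?m = "Suc n"
    let ?A = "parts_in UNIV {2..?m}" and ?B = "parts_in UNIV {?m<..}"
    let ?h = "\<lambda>(\<alpha>, \<beta>). \<alpha> + \<beta> + replicate_mset ?m 1"
    have h: "ones (?h (\<alpha>, \<beta>)) = ?m" "mu (?h (\<alpha>, \<beta>)) = size \<beta>"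
        "filter_mset (\<lambda>k. k \<in> {2..?m}) (?h (\<alpha>, \<beta>)) = \<alpha>"
        "filter_mset (\<lambda>k. k \<in> {?m<..}) (?h (\<alpha>, \<beta>)) = \<beta>"
      if "\<alpha> \<in> ?A" "\<beta> \<in> ?B" for \<alpha> \<beta>
    proof -
      have [simp]: "1 \<notin># \<alpha>" "1 \<notin># \<beta>" using that by (auto simp: parts_in_def)
      show ones: "ones (?h (\<alpha>, \<beta>)) = ?m"
        by (simp add: ones_def count_eq_zero_iff del: One_nat_def)
      have [simp]: "{#k \<in># \<alpha>. ?m < k#} = {#}" "{#k \<in># \<beta>. ?m < k#} = \<beta>"
          "{#k \<in># \<beta>. k \<in> {2..?m}#} = {#}" "{#k \<in># \<alpha>. k \<in> {2..?m}#} = \<alpha>"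
        using that by (auto simp: filter_mset_eq_conv parts_in_def)
      have [simp]: "{#k \<in># replicate_mset ?m 1. ?m < k#} = {#}"
          "{#k \<in># replicate_mset ?m (1::nat). k \<in> {2..?m}#} = {#}"
        by (auto simp: filter_mset_eq_conv simp del: replicate_mset_Suc)
      show "mu (?h (\<alpha>, \<beta>)) = size \<beta>"
        unfolding mu_def ones by (simp del: replicate_mset_Suc One_nat_def)
      show "filter_mset (\<lambda>k. k \<in> {2..?m}) (?h (\<alpha>, \<beta>)) = \<alpha>"
        by (simp del: replicate_mset_Suc One_nat_def atLeastAtMost_iff)
      show "filter_mset (\<lambda>k. k \<in> {?m<..}) (?h (\<alpha>, \<beta>)) = \<beta>"
        by (simp del: replicate_mset_Suc One_nat_def)
    qed
    have bij: "bij_betw ?h (?A \<times> ?B) {\<pi>\<in>?S. ones \<pi> = ?m}"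
    proof (rule bij_betwI[where g = "\<lambda>\<pi>. (filter_mset (\<lambda>k. k \<in> {2..?m}) \<pi>, filter_mset (\<lambda>k. k \<in> {?m<..}) \<pi>)"])
      show "?h \<in> ?A \<times> ?B \<rightarrow> {\<pi>\<in>?S. ones \<pi> = ?m}"
      proof (rule Pi_I)
        fix x assume "x \<in> ?A \<times> ?B"
        then obtain \<alpha> \<beta> where x: "x = (\<alpha>, \<beta>)" and ab: "\<alpha> \<in> ?A" "\<beta> \<in> ?B" by auto
        have "0 \<notin># \<alpha> + \<beta> + replicate_mset ?m 1"
          using ab by (auto simp: parts_in_def)
        then show "?h x \<in> {\<pi>\<in>?S. ones \<pi> = ?m}"
          using h(1)[OF ab] by (simp add: x partitions_def del: replicate_mset_Suc)
      qed
      show "(\<lambda>\<pi>. (filter_mset (\<lambda>k. k \<in> {2..?m}) \<pi>, filter_mset (\<lambda>k. k \<in> {?m<..}) \<pi>))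
          \<in> {\<pi>\<in>?S. ones \<pi> = ?m} \<rightarrow> ?A \<times> ?B"
        by (auto simp: parts_in_def)
      show "(filter_mset (\<lambda>k. k \<in> {2..?m}) (?h x), filter_mset (\<lambda>k. k \<in> {?m<..}) (?h x)) = x"
        if "x \<in> ?A \<times> ?B" for x
        using h(3,4) that by (cases x) auto
      show "?h (filter_mset (\<lambda>k. k \<in> {2..?m}) \<pi>, filter_mset (\<lambda>k. k \<in> {?m<..}) \<pi>) = \<pi>"
        if "\<pi> \<in> {\<pi>\<in>?S. ones \<pi> = ?m}" for \<pi>
      \<comment> \<open>The two filters miss only 0, which is not a part, and 1, whose multiplicity
        is prescribed by the fibre.\<close>
      proof (rule multiset_eqI)
        fix k
        have "count \<pi> 0 = 0" "count \<pi> 1 = ?m"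
          using that by (auto simp: partitions_def ones_def not_in_iff)
        moreover have "k = 0 \<or> k = 1 \<or> k \<in> {2..?m} \<or> k \<in> {?m<..}" by auto
        ultimately show "count (?h (filter_mset (\<lambda>k. k \<in> {2..?m}) \<pi>, filter_mset (\<lambda>k. k \<in> {?m<..}) \<pi>)) k
            = count \<pi> k"
          by (auto simp del: replicate_mset_Suc)
      qed
    qed
    have "f ?m = gf (?A \<times> ?B) (\<lambda>x. d * ?m + (case x of (\<alpha>, \<beta>) \<Rightarrow> ?s \<alpha> + ?s \<beta>))
        (\<lambda>x. zw (- int ?m) * (case x of (\<alpha>, \<beta>) \<Rightarrow>
            \<Prod>\<^sub># (image_mset (\<lambda>_. 1) \<alpha>) * \<Prod>\<^sub># (image_mset (\<lambda>_. zw 1) \<beta>)))"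
      unfolding f_def
    proof (rule gf_bij_betw[OF bij])
      fix x assume "x \<in> ?A \<times> ?B"
      then obtain \<alpha> \<beta> where x: "x = (\<alpha>, \<beta>)" "\<alpha> \<in> ?A" "\<beta> \<in> ?B" by auto
      show "d * \<Sum>\<^sub># (?h x) = d * ?m + (case x of (\<alpha>, \<beta>) \<Rightarrow> ?s \<alpha> + ?s \<beta>)"
        by (simp add: x(1) add_mult_distrib2 del: replicate_mset_Suc)
      have "crank (?h x) = - int ?m + int (size \<beta>)"
        using h(1,2)[OF x(2,3)] by (simp add: crank_def x(1) del: replicate_mset_Suc)
      then show "zw (crank (?h x)) = zw (- int ?m) * (case x of (\<alpha>, \<beta>) \<Rightarrow>
            \<Prod>\<^sub># (image_mset (\<lambda>_. 1) \<alpha>) * \<Prod>\<^sub># (image_mset (\<lambda>_. zw 1) \<beta>))"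
        by (simp only: prod_mset_zw zw_add x(1)) simp
    qed
    also have "\<dots> = fps_const (zw (- int ?m)) * fps_X ^ (d * ?m)
        * (noones_upto_gf d ?m * part_gf UNIV d {?m<..} (\<lambda>_. zw 1))"
      unfolding gf_shift noones_upto_gf_def part_gf_def
      using assms by (subst gf_Times) (auto intro: finite_fibres_parts_in)
    also have "fps_const (zw (- int ?m)) * fps_X ^ (d * ?m) = ?t ^ ?m"
      unfolding power_mult_distrib zpow_power power_mult by simp
    finally show ?thesis by (simp only: mult.commute)
  qed
  have "gf ?S ?s ?w = fps_suminf f"
    unfolding f_def by (rule gf_fibration[OF fin le])
  also have "\<dots> = f 0 + fps_suminf (\<lambda>n. f (Suc n))"
    by (rule fps_suminf_Suc) (rule f_low)
  finally show ?thesis by (simp only: fS f0 add_0)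
qed

text \<open>The summand \<open>(z - 1) q\<close> is the anomaly of the crank at the partition \<open>1\<close>: its crank is \<open>-1\<close>,
  whereas the product has coefficient \<open>z - 1 + z\<^sup>-\<^sup>1\<close> at \<open>q\<close>.\<close>

lemma crank_gf:
  assumes "d > 0"
  shows "crank_series d = 1 - fps_X ^ d + zpow 1 * fps_X ^ d
    + gf (partitions - {{#}}) (\<lambda>\<pi>. d * \<Sum>\<^sub># \<pi>) (\<lambda>\<pi>. zw (crank \<pi>))"
proof -
  let ?S = "{\<pi>\<in>partitions. \<pi> \<noteq> {#} \<and> ones \<pi> = 0}" and ?T = "{\<pi>\<in>partitions. ones \<pi> > 0}"
  have "partitions - {{#}} = ?S \<union> ?T" by (auto simp: ones_def count_eq_zero_iff)
  moreover have "finite_fibres ?S (\<lambda>\<pi>. d * \<Sum>\<^sub># \<pi>)" "finite_fibres ?T (\<lambda>\<pi>. d * \<Sum>\<^sub># \<pi>)"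
    by (auto intro: finite_fibres_subset[OF finite_fibres_partitions[OF assms]])
  moreover have "?S \<inter> ?T = {}" by auto
  ultimately have "gf (partitions - {{#}}) (\<lambda>\<pi>. d * \<Sum>\<^sub># \<pi>) (\<lambda>\<pi>. zw (crank \<pi>))
      = gf ?S (\<lambda>\<pi>. d * \<Sum>\<^sub># \<pi>) (\<lambda>\<pi>. zw (crank \<pi>)) + gf ?T (\<lambda>\<pi>. d * \<Sum>\<^sub># \<pi>) (\<lambda>\<pi>. zw (crank \<pi>))"
    by (simp only: gf_Un)
  then show ?thesis
    unfolding crank_series_def crank_gf_no_ones[OF assms] crank_gf_ones[OF assms]
    by (simp only: add.assoc)
qed

section \<open>Overpartitions\<close>

lemma PD_eq: "PD = parts_in {1} {0<..}"
proof (intro equalityI subsetI)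
  fix \<pi> assume \<pi>: "\<pi> \<in> PD"
  have "0 < k \<and> count \<pi> k = 1" if "k \<in># \<pi>" for k
  proof -
    have "count \<pi> k \<le> 1" "count \<pi> k > 0" "0 \<notin># \<pi>"
      using \<pi> that by (auto simp: PD_def partitions_def)
    then show ?thesis using that by (cases "k = 0") (simp_all add: le_antisym)
  qed
  then show "\<pi> \<in> parts_in {1} {0<..}" by (simp add: parts_in_def)
next
  fix \<pi> assume \<pi>: "\<pi> \<in> parts_in {1} {0<..}"
  have "count \<pi> k \<le> 1" for k
    using \<pi> by (cases "k \<in># \<pi>") (auto simp: parts_in_def not_in_iff)
  with \<pi> show "\<pi> \<in> PD" by (auto simp: PD_def partitions_def parts_in_def)
qed

lemma PO_eq: "PO = parts_in UNIV {k. odd k}"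
  by (auto simp: PO_def partitions_def parts_in_def)

lemma finite_fibres_PD: "finite_fibres PD sum_mset"
  using finite_fibres_parts_in[of 1 "{0<..}" "{1}"] by (simp add: PD_eq)

lemma finite_fibres_PO: "finite_fibres PO sum_mset"
  using finite_fibres_parts_in[of 1 "{k. odd k}" UNIV] by (simp add: PO_eq)

lemma finite_fibres_PE: "finite_fibres PE sum_mset"
  by (rule finite_fibres_subset[of partitions])
     (use finite_fibres_partitions[of 1] in \<open>auto simp: PE_def\<close>)

lemma PD_gf: "gf PD sum_mset (\<lambda>_. 1) = qpoch_inf (- qvar) qvar"
proof -
  have "range Suc = {0<..}" by (auto simp: image_iff gr0_conv_Suc)
  moreover have "qpoch_inf (- qvar) qvar = part_gf {1} 1 (range Suc) (\<lambda>_. 1)"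
    by (rule qpoch_inf_eq_distinct_part_gf) auto
  ultimately show ?thesis
    by (simp add: part_gf_def PD_eq)
qed

lemma PO_gf: "gf PO sum_mset (\<lambda>_. 1) * qpoch_inf qvar (qvar\<^sup>2) = 1"
proof -
  have "range (\<lambda>k. 2 * k + 1) = {k::nat. odd k}" by (auto elim: oddE)
  moreover have "part_gf UNIV 1 (range (\<lambda>k. 2 * k + 1)) (\<lambda>_. 1) * qpoch_inf qvar (qvar\<^sup>2) = 1"
    by (rule part_gf_mult_qpoch_inf) (auto simp: inj_def power_mult power_add)
  ultimately show ?thesis
    by (simp add: part_gf_def PO_eq)
qed

text \<open>Halving all parts halves the size, which is why the crank series is needed with
  \<open>d = 2\<close>.\<close>

lemma PE_gf:
  "gf (PE - {{#}}) sum_mset (\<lambda>\<pi>. zw (crank (half \<pi>)))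
    = gf (partitions - {{#}}) (\<lambda>\<pi>. 2 * \<Sum>\<^sub># \<pi>) (\<lambda>\<pi>. zw (crank \<pi>))"
proof (rule gf_bij_betw[of "image_mset (\<lambda>k. 2 * k)"])
  have half: "half (image_mset (\<lambda>k. 2 * k) \<pi>) = \<pi>" for \<pi>
    by (simp add: half_def multiset.map_comp comp_def)
  show "bij_betw (image_mset (\<lambda>k. 2 * k)) (partitions - {{#}}) (PE - {{#}})"
  proof (rule bij_betwI[where g = half])
    show "image_mset (\<lambda>k. 2 * k) \<in> partitions - {{#}} \<rightarrow> PE - {{#}}"
      by (auto simp: partitions_def PE_def)
    show "half \<in> PE - {{#}} \<rightarrow> partitions - {{#}}"
    proof (rule Pi_I)
      fix \<pi> assume \<pi>: "\<pi> \<in> PE - {{#}}"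
      have "k div 2 \<noteq> 0" if "k \<in># \<pi>" for k
      proof -
        have "even k" "0 \<notin># \<pi>"
          using \<pi> that by (auto simp: PE_def partitions_def)
        moreover from this that have "k \<noteq> 0" by metis
        ultimately show ?thesis by (auto elim: evenE)
      qed
      with \<pi> show "half \<pi> \<in> partitions - {{#}}"
        by (force simp: partitions_def half_def)
    qed
    show "image_mset (\<lambda>k. 2 * k) (half \<pi>) = \<pi>" if "\<pi> \<in> PE - {{#}}" for \<pi>
    proof -
      have "image_mset (\<lambda>k. 2 * k) (half \<pi>) = image_mset (\<lambda>k. k) \<pi>"
        unfolding half_def multiset.map_comp comp_def
        using that by (intro image_mset_cong) (auto simp: PE_def)
      then show ?thesis by simp
    qed
  qed (simp add: half)
  show "zw (crank (half (image_mset (\<lambda>k. 2 * k) \<pi>))) = zw (crank \<pi>)" for \<pi>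
    by (simp add: half)
  show "\<Sum>\<^sub># (image_mset (\<lambda>k. 2 * k) \<pi>) = 2 * \<Sum>\<^sub># \<pi>" for \<pi> :: "nat multiset"
    by (induction \<pi>) auto
qed

section \<open>Distinct parts and kappa\<close>

definition raise_largest :: "nat multiset \<Rightarrow> nat multiset" where
  "raise_largest \<pi> = (if \<pi> = {#} then {#2#} else add_mset (largest \<pi> + 2) (\<pi> - {#largest \<pi>#}))"

text \<open>The partition 2 is treated separately because lowering its part would create a part
  0.\<close>

definition lower_largest :: "nat multiset \<Rightarrow> nat multiset" where
  "lower_largest \<pi> = (if \<pi> = {#2#} then {#} else add_mset (largest \<pi> - 2) (\<pi> - {#largest \<pi>#}))"

lemma largest_eqI: "k \<in># \<pi> \<Longrightarrow> (\<And>j. j \<in># \<pi> \<Longrightarrow> j \<le> k) \<Longrightarrow> largest \<pi> = k"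
  unfolding largest_def by (rule Max_eqI) auto

lemma in_PD_iff: "\<pi> \<in> PD \<longleftrightarrow> 0 \<notin># \<pi> \<and> (\<forall>k. count \<pi> k \<le> 1)"
  by (simp add: PD_def partitions_def)

lemma PD_add_mset: "add_mset k \<rho> \<in> PD \<longleftrightarrow> 0 < k \<and> k \<notin># \<rho> \<and> \<rho> \<in> PD"
proof -
  have "(\<forall>j. count (add_mset k \<rho>) j \<le> 1) \<longleftrightarrow> k \<notin># \<rho> \<and> (\<forall>j. count \<rho> j \<le> 1)"
  proof (intro iffI conjI allI)
    assume *: "\<forall>j. count (add_mset k \<rho>) j \<le> 1"
    then show "k \<notin># \<rho>" by (metis add_le_same_cancel1 count_add_mset count_eq_zero_iff le_zero_eq plus_1_eq_Suc)
    show "count \<rho> j \<le> 1" for j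
      using *[rule_format, of j] by (simp split: if_splits)
  next
    fix j assume "k \<notin># \<rho> \<and> (\<forall>j. count \<rho> j \<le> 1)"
    then show "count (add_mset k \<rho>) j \<le> 1"
      by (cases "j = k") (auto simp: count_eq_zero_iff)
  qed
  then show ?thesis by (auto simp: in_PD_iff)
qed

text \<open>The cases of \<open>kappa\<close> become one gap condition: apart from the partition 2,
  the value 1 means that all other parts are at least 3 below \<open>l\<close>, so that
  \<open>l - 2\<close> is still strictly the largest part. For \<open>l = 3\<close> this leaves no
  room for another part.\<close>

lemma kappa_add_mset:
  assumes l: "0 < l" and \<rho>: "\<And>j. j \<in># \<rho> \<Longrightarrow> 0 < j \<and> j < l"
  shows "kappa (add_mset l \<rho>)
    = (if l = 2 \<and> \<rho> = {#} \<or> 3 \<le> l \<and> (\<forall>j\<in>#\<rho>. j < l - 2) then 1 else 0)"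
proof -
  have lg: "largest (add_mset l \<rho>) = l"
    using \<rho> by (intro largest_eqI) (auto intro: less_imp_le)
  consider "l = 1" | "l = 2" | "l = 3" | "l \<ge> 4" using l by linarith
  then show ?thesis
  proof cases
    case 3
    have "(\<forall>j\<in>#\<rho>. j < 1) \<longleftrightarrow> \<rho> = {#}"
    proof
      assume "\<forall>j\<in>#\<rho>. j < 1"
      with \<rho> have "set_mset \<rho> = {}" by fastforce
      then show "\<rho> = {#}" by simp
    qed simp
    then show ?thesis unfolding kappa_def lg using 3 by simp
  next
    case 4
    have "l - 1 \<notin># \<rho> \<and> l - 2 \<notin># \<rho> \<longleftrightarrow> (\<forall>j\<in>#\<rho>. j < l - 2)"
    proof
      assume *: "l - 1 \<notin># \<rho> \<and> l - 2 \<notin># \<rho>"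
      show "\<forall>j\<in>#\<rho>. j < l - 2"
      proof
        fix j assume j: "j \<in># \<rho>"
        then have "j < l" "j \<noteq> l - 1" "j \<noteq> l - 2" using \<rho> * by auto
        then show "j < l - 2" by linarith
      qed
    qed fastforce
    then show ?thesis unfolding kappa_def lg using 4 by auto
  next
    case 1
    then show ?thesis unfolding kappa_def lg by simp
  next
    case 2
    then show ?thesis unfolding kappa_def lg by simp
  qed
qed

lemma PD_cases:
  assumes "\<pi> \<in> PD" "\<pi> \<noteq> {#}"
  obtains l \<rho> where "\<pi> = add_mset l \<rho>" "0 < l" "\<rho> \<in> PD" "\<And>j. j \<in># \<rho> \<Longrightarrow> 0 < j \<and> j < l"
proof
  define l where "l = largest \<pi>"
  have l: "l \<in># \<pi>" unfolding l_def using assms(2) by (rule largest_in)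
  then show eq: "\<pi> = add_mset l (\<pi> - {#l#})" by simp
  then have *: "0 < l" "l \<notin># \<pi> - {#l#}" "\<pi> - {#l#} \<in> PD"
    using assms(1) PD_add_mset[of l "\<pi> - {#l#}"] by auto
  then show "0 < l" "\<pi> - {#l#} \<in> PD" by auto
  show "0 < j \<and> j < l" if "j \<in># \<pi> - {#l#}" for j
  proof -
    have "j \<noteq> l" "j \<le> l"
      using that * le_largest[of j \<pi>] in_diffD[OF that] by (auto simp: l_def)
    moreover have "j \<noteq> 0" using that *(3) unfolding in_PD_iff by metis
    ultimately show ?thesis by simp
  qed
qed

lemma bij_betw_raise_largest:
  "bij_betw raise_largest PD {\<pi>\<in>PD. \<pi> \<noteq> {#} \<and> kappa \<pi> = 1}"
proof (rule bij_betwI[where g = lower_largest])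
  have raise: "raise_largest (add_mset l \<rho>) = add_mset (l + 2) \<rho>"
    if "\<And>j. j \<in># \<rho> \<Longrightarrow> 0 < j \<and> j < l" for l \<rho>
  proof -
    have "largest (add_mset l \<rho>) = l"
      using that by (intro largest_eqI) (auto intro: less_imp_le)
    then show ?thesis by (simp add: raise_largest_def)
  qed
  have lower: "lower_largest (add_mset l \<rho>) = add_mset (l - 2) \<rho>"
    if "3 \<le> l" "\<And>j. j \<in># \<rho> \<Longrightarrow> 0 < j \<and> j < l" for l \<rho>
  proof -
    have "largest (add_mset l \<rho>) = l"
      using that by (intro largest_eqI) (auto intro: less_imp_le)
    moreover have "add_mset l \<rho> \<noteq> {#2#}" using that(1) by auto
    ultimately show ?thesis by (simp add: lower_largest_def)
  qed
  have empty: "{#} \<in> PD" by (simp add: in_PD_iff)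
  have kappa2: "kappa {#2#} = 1" by (simp add: kappa_def largest_def)
  show "raise_largest \<in> PD \<rightarrow> {\<pi>\<in>PD. \<pi> \<noteq> {#} \<and> kappa \<pi> = 1}"
  proof
    fix \<pi> assume \<pi>: "\<pi> \<in> PD"
    show "raise_largest \<pi> \<in> {\<pi>\<in>PD. \<pi> \<noteq> {#} \<and> kappa \<pi> = 1}"
    proof (cases "\<pi> = {#}")
      case True
      then show ?thesis using empty kappa2 by (simp add: raise_largest_def PD_add_mset)
    next
      case False
      then obtain l \<rho> where r: "\<pi> = add_mset l \<rho>" "0 < l" "\<rho> \<in> PD" "\<And>j. j \<in># \<rho> \<Longrightarrow> 0 < j \<and> j < l"
        using PD_cases[OF \<pi>] by blast
      have "0 < j \<and> j < l + 2" if "j \<in># \<rho>" for j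
        using r(4)[OF that] by auto
      then have "kappa (add_mset (l + 2) \<rho>) = 1"
        using r by (subst kappa_add_mset) auto
      moreover have "l + 2 \<notin># \<rho>" using r(4) by fastforce
      ultimately show ?thesis using r by (simp add: raise PD_add_mset)
    qed
  qed
  \<comment> \<open>Both bounds on the remaining parts are provided: \<open>j < l\<close> is needed
    to apply \<open>lower\<close>, and \<open>j < l - 2\<close> to apply \<open>raise\<close>
    afterwards.\<close>
  have cases: thesis
    if "\<pi> \<in> {\<pi>\<in>PD. \<pi> \<noteq> {#} \<and> kappa \<pi> = 1}" "\<pi> = {#2#} \<Longrightarrow> thesis"
      "\<And>l \<rho>. \<pi> = add_mset l \<rho> \<Longrightarrow> 3 \<le> l \<Longrightarrow> \<rho> \<in> PD \<Longrightarrow> (\<And>j. j \<in># \<rho> \<Longrightarrow> 0 < j \<and> j < l)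
        \<Longrightarrow> (\<And>j. j \<in># \<rho> \<Longrightarrow> 0 < j \<and> j < l - 2) \<Longrightarrow> thesis" for \<pi> thesis
  proof -
    have "\<pi> \<in> PD" "\<pi> \<noteq> {#}" using that(1) by auto
    then obtain l \<rho> where r: "\<pi> = add_mset l \<rho>" "0 < l" "\<rho> \<in> PD" "\<And>j. j \<in># \<rho> \<Longrightarrow> 0 < j \<and> j < l"
      by (rule PD_cases) blast
    have "kappa (add_mset l \<rho>) = 1" using that(1) r(1) by simp
    then have "l = 2 \<and> \<rho> = {#} \<or> 3 \<le> l \<and> (\<forall>j\<in>#\<rho>. j < l - 2)"
      using kappa_add_mset[OF r(2,4)] by (metis zero_neq_one)
    then show thesis
      using that(2,3) r by auto
  qed
  show "lower_largest \<in> {\<pi>\<in>PD. \<pi> \<noteq> {#} \<and> kappa \<pi> = 1} \<rightarrow> PD"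
  proof
    fix \<pi> assume "\<pi> \<in> {\<pi>\<in>PD. \<pi> \<noteq> {#} \<and> kappa \<pi> = 1}"
    then show "lower_largest \<pi> \<in> PD"
    proof (rule cases)
      fix l \<rho> assume r: "\<pi> = add_mset l \<rho>" "3 \<le> l" "\<rho> \<in> PD" "\<And>j. j \<in># \<rho> \<Longrightarrow> 0 < j \<and> j < l"
        "\<And>j. j \<in># \<rho> \<Longrightarrow> 0 < j \<and> j < l - 2"
      have "l - 2 \<notin># \<rho>" using r(5) by blast
      then show ?thesis using r(1-3) lower[OF r(2,4)] by (simp add: PD_add_mset)
    qed (simp add: lower_largest_def empty)
  qed
  show "lower_largest (raise_largest \<pi>) = \<pi>" if \<pi>: "\<pi> \<in> PD" for \<pi>
  proof (cases "\<pi> = {#}")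
    case False
    then obtain l \<rho> where r: "\<pi> = add_mset l \<rho>" "0 < l" "\<rho> \<in> PD" "\<And>j. j \<in># \<rho> \<Longrightarrow> 0 < j \<and> j < l"
      using PD_cases[OF \<pi>] by blast
    have *: "0 < j \<and> j < l + 2" if "j \<in># \<rho>" for j
      using r(4)[OF that] by auto
    have "raise_largest \<pi> = add_mset (l + 2) \<rho>" unfolding r(1) by (rule raise[OF r(4)])
    then show ?thesis using lower[OF _ *] r(1,2) by simp
  qed (simp add: raise_largest_def lower_largest_def)
  show "raise_largest (lower_largest \<pi>) = \<pi>"
    if "\<pi> \<in> {\<pi>\<in>PD. \<pi> \<noteq> {#} \<and> kappa \<pi> = 1}" for \<pi>
    using that
  proof (rule cases)
    fix l \<rho> assume r: "\<pi> = add_mset l \<rho>" "3 \<le> l" "\<rho> \<in> PD" "\<And>j. j \<in># \<rho> \<Longrightarrow> 0 < j \<and> j < l"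
      "\<And>j. j \<in># \<rho> \<Longrightarrow> 0 < j \<and> j < l - 2"
    then show ?thesis using lower[OF r(2,4)] raise[OF r(5)] by simp
  qed (simp add: raise_largest_def lower_largest_def)
qed

lemma sum_mset_raise_largest: "\<Sum>\<^sub># (raise_largest \<pi>) = 2 + \<Sum>\<^sub># \<pi>"
proof (cases "\<pi> = {#}")
  case False
  then obtain \<rho> where "\<pi> = add_mset (largest \<pi>) \<rho>"
    by (metis insert_DiffM largest_in)
  then show ?thesis
    using False by (metis (no_types, lifting) add.assoc add.commute add_mset_remove_trivial
      raise_largest_def sum_mset.add_mset)
qed (simp add: raise_largest_def)

text \<open>\<open>kappa\<close> takes only the values 0 and 1, and the partitions with value 1 have
  the series q^2 D, where D is the series of all partitions into distinct parts. On them the weight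
  1 is traded for z.\<close>

lemma kappa_gf:
  "gf PD sum_mset (\<lambda>\<pi>. zw (if \<pi> \<noteq> {#} then kappa \<pi> else 0))
    = (1 - qvar\<^sup>2 + zpow 1 * qvar\<^sup>2) * gf PD sum_mset (\<lambda>_. 1)"
    (is "gf PD sum_mset ?w = _")
proof -
  let ?K = "{\<pi>\<in>PD. \<pi> \<noteq> {#} \<and> kappa \<pi> = 1}"
  \<comment> \<open>The weight \<open>c\<close> is kept general: z is used to add these partitions
    and 1 to subtract them.\<close>
  have K: "gf ?K sum_mset (\<lambda>_. c) = fps_const c * qvar\<^sup>2 * gf PD sum_mset (\<lambda>_. 1)" for c
  proof -
    have "gf ?K sum_mset (\<lambda>_. c) = gf PD (\<lambda>\<pi>. 2 + \<Sum>\<^sub># \<pi>) (\<lambda>_. c * 1)"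
      by (rule gf_bij_betw[OF bij_betw_raise_largest]) (simp_all add: sum_mset_raise_largest)
    then show ?thesis unfolding gf_shift .
  qed
  have split: "gf PD sum_mset w = gf (PD - ?K) sum_mset w + gf ?K sum_mset w"
    for w :: "nat multiset \<Rightarrow> laurent_poly"
  proof -
    have "PD = (PD - ?K) \<union> ?K" by auto
    then have "gf PD sum_mset w = gf ((PD - ?K) \<union> ?K) sum_mset w" by simp
    also have "\<dots> = gf (PD - ?K) sum_mset w + gf ?K sum_mset w"
      by (rule gf_Un) (auto intro: finite_fibres_subset[OF finite_fibres_PD])
    finally show ?thesis .
  qed
  have "gf (PD - ?K) sum_mset ?w = gf (PD - ?K) sum_mset (\<lambda>_. 1)"
    by (rule gf_cong) (auto simp: kappa_def zw_0)
  moreover have "gf ?K sum_mset ?w = gf ?K sum_mset (\<lambda>_. zw 1)"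
    by (rule gf_cong) auto
  ultimately have "gf PD sum_mset ?w
      = gf (PD - ?K) sum_mset (\<lambda>_. 1) + zpow 1 * qvar\<^sup>2 * gf PD sum_mset (\<lambda>_. 1)"
    unfolding split[of ?w] K[of "zw 1"] zpow_def by simp
  moreover have "gf (PD - ?K) sum_mset (\<lambda>_. 1)
      = gf PD sum_mset (\<lambda>_. 1 :: laurent_poly) - qvar\<^sup>2 * gf PD sum_mset (\<lambda>_. 1)"
  proof -
    have "gf (PD - ?K) sum_mset (\<lambda>_. 1)
        = gf PD sum_mset (\<lambda>_. 1) - gf ?K sum_mset (\<lambda>_. 1 :: laurent_poly)"
      unfolding eq_diff_eq by (rule split[symmetric])
    then show ?thesis unfolding K[of 1] by simp
  qed
  ultimately show ?thesis
    by (simp only: distrib_right left_diff_distrib mult_1)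
qed

text \<open>The sum is bracketed like the nested product, so that \<open>gf_Times\<close> applies
  twice.\<close>

definition overpartition_size :: "overpartition \<Rightarrow> nat" where
  "overpartition_size = (\<lambda>(\<pi>1, \<pi>2, \<pi>3). \<Sum>\<^sub># \<pi>1 + (\<Sum>\<^sub># \<pi>2 + \<Sum>\<^sub># \<pi>3))"

lemma overpartitions_eq: "overpartitions n = {\<pi> \<in> PD \<times> PE \<times> PO. overpartition_size \<pi> = n}"
  by (auto simp: overpartitions_def overpartition_size_def)

lemma finite_fibres_overpartitions: "finite_fibres (PD \<times> PE \<times> PO) overpartition_size"
  unfolding finite_fibres_def using finite_overpartitions by (simp flip: overpartitions_eq)

lemma gf_triple:
  assumes "finite_fibres A sum_mset" "finite_fibres B sum_mset" "finite_fibres C sum_mset"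
  shows "gf (A \<times> B \<times> C) overpartition_size (\<lambda>(\<alpha>, \<beta>, \<gamma>). u \<alpha> * (v \<beta> * w \<gamma>))
    = gf A sum_mset u * (gf B sum_mset v * gf C sum_mset w)"
proof -
  have "gf (A \<times> B \<times> C) overpartition_size (\<lambda>(\<alpha>, \<beta>, \<gamma>). u \<alpha> * (v \<beta> * w \<gamma>))
      = gf (A \<times> (B \<times> C)) (\<lambda>(\<alpha>, y). \<Sum>\<^sub># \<alpha> + (case y of (\<beta>, \<gamma>) \<Rightarrow> \<Sum>\<^sub># \<beta> + \<Sum>\<^sub># \<gamma>))
          (\<lambda>(\<alpha>, y). u \<alpha> * (case y of (\<beta>, \<gamma>) \<Rightarrow> v \<beta> * w \<gamma>))"
    by (rule gf_cong) (auto simp: overpartition_size_def)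
  also have "\<dots> = gf A sum_mset u * (gf B sum_mset v * gf C sum_mset w)"
    using assms by (simp add: gf_Times finite_fibres_Times)
  finally show ?thesis .
qed

text \<open>Nonempty even components contribute the crank series without its terms 1 - q^2 + z q^2.
  The empty even component restores exactly these terms through \<open>kappa_gf\<close>, with the
  distinct and odd factors common to both cases.\<close>

lemma overpartition_gf:
  "gf (PD \<times> PE \<times> PO) overpartition_size (\<lambda>\<pi>. zw (crank2 \<pi>))
    = gf PD sum_mset (\<lambda>_. 1) * (crank_series 2 * gf PO sum_mset (\<lambda>_. 1))"
    (is "gf _ ?s ?w = ?D * (_ * ?O)")
proof -
  let ?E = "PE - {{#}}"
  have "{#} \<in> PE" by (simp add: PE_def partitions_def)
  then have "PD \<times> PE \<times> PO = PD \<times> ?E \<times> PO \<union> PD \<times> {{#}} \<times> PO" by auto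
  then have "gf (PD \<times> PE \<times> PO) ?s ?w = gf (PD \<times> ?E \<times> PO \<union> PD \<times> {{#}} \<times> PO) ?s ?w" by simp
  also have "\<dots> = gf (PD \<times> ?E \<times> PO) ?s ?w + gf (PD \<times> {{#}} \<times> PO) ?s ?w"
    using \<open>{#} \<in> PE\<close>
    by (intro gf_Un) (auto intro!: finite_fibres_subset[OF finite_fibres_overpartitions])
  also have "gf (PD \<times> ?E \<times> PO) ?s ?w
      = gf (PD \<times> ?E \<times> PO) ?s (\<lambda>(\<alpha>, \<beta>, \<gamma>). 1 * (zw (crank (half \<beta>)) * 1))"
    by (rule gf_cong) (auto split: if_splits)
  also have "\<dots> = ?D * (gf ?E sum_mset (\<lambda>\<pi>. zw (crank (half \<pi>))) * ?O)"
    by (intro gf_triple finite_fibres_PD finite_fibres_PO finite_fibres_subset[OF finite_fibres_PE]) auto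
  also have "gf (PD \<times> {{#}} \<times> PO) ?s ?w
      = gf (PD \<times> {{#}} \<times> PO) ?s (\<lambda>(\<alpha>, \<beta>, \<gamma>). zw (if \<alpha> \<noteq> {#} then kappa \<alpha> else 0) * (1 * 1))"
    by (rule gf_cong) auto
  also have "\<dots> = gf PD sum_mset (\<lambda>\<pi>. zw (if \<pi> \<noteq> {#} then kappa \<pi> else 0))
      * (gf {{#}} sum_mset (\<lambda>_. 1) * ?O)"
    by (intro gf_triple finite_fibres_PD finite_fibres_PO finite_fibres_finite) auto
  also have "gf {{#}} sum_mset (\<lambda>_. 1) = (1 :: laurent_poly fps)"
    by (simp add: gf_singleton)
  also have "gf PD sum_mset (\<lambda>\<pi>. zw (if \<pi> \<noteq> {#} then kappa \<pi> else 0)) * (1 * ?O)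
      = ?D * ((1 - qvar\<^sup>2 + zpow 1 * qvar\<^sup>2) * ?O)"
    unfolding kappa_gf by (simp only: mult_ac mult_1)
  finally show ?thesis
    unfolding PE_gf crank_gf[of 2, simplified] by (simp only: distrib_left distrib_right add_ac)
qed

theorem theorem1p4:
  fixes n :: nat and m :: int
  shows "int (card {\<pi> \<in> overpartitions n. crank2 \<pi> = m}) = M2bar m n"
proof -
  let ?G = "gf (PD \<times> PE \<times> PO) overpartition_size (\<lambda>\<pi>. zw (crank2 \<pi>))"
  let ?D = "gf PD sum_mset (\<lambda>_. 1) :: laurent_poly fps"
  let ?O = "gf PO sum_mset (\<lambda>_. 1) :: laurent_poly fps"
  have "?G * M2bar_den = ?D * (crank_series 2 * (qpoch_inf (zpow 1 * qvar\<^sup>2) (qvar\<^sup>2)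
      * qpoch_inf (zpow (-1) * qvar\<^sup>2) (qvar\<^sup>2))) * (?O * qpoch_inf qvar (qvar\<^sup>2))"
    unfolding overpartition_gf M2bar_den_def by (simp only: mult_ac)
  also have "\<dots> = M2bar_num"
    unfolding PO_gf PD_gf M2bar_num_def by (subst crank_series_mult) simp_all
  \<comment> \<open>Only here is the identity divided by the denominator, through uniqueness of the
    quotient.\<close>
  finally have G: "?G = M2bar_gf"
    by (simp add: M2bar_gf_unique)
  have "M2bar m n = Poly_Mapping.lookup (\<Sum>\<pi>\<in>overpartitions n. zw (crank2 \<pi>)) m"
    unfolding M2bar_def G[symmetric] by (simp add: gf_def overpartitions_eq)
  \<comment> \<open>The coefficient of z^m in a monomial is the indicator of its exponent being
    \<open>m\<close>, so the lookup counts.\<close>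
  also have "\<dots> = (\<Sum>\<pi>\<in>overpartitions n. if crank2 \<pi> = m then 1 else 0)"
    by (simp add: lookup_sum lookup_single when_def eq_commute)
  also have "\<dots> = int (card {\<pi> \<in> overpartitions n. crank2 \<pi> = m})"
    using finite_overpartitions[of n] by (simp add: sum.If_cases Int_def)
  finally show ?thesis by simp
qed

end
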